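(* For every integer $r\geq 10$, the Vietoris--Rips complex $\mathrm{VR}(\mathbb{Z}^6;r)$ is contractible.
   Context: $\mathbb{Z}^6$ is equipped with the Manhattan metric $d(x,y)=\sum_{i=1}^6 |x_i-y_i|$. For a metric space $X$ and $r\geq 0$, $\mathrm{VR}(X;r)$ is the simplicial complex with vertex set $X$ whose simplices are the finite subsets of $X$ of diameter at most $r$. *)

theory Defs
  imports "HOL-Analysis.Analysis"
begin

definition manhattan :: "int^6 \<Rightarrow> int^6 \<Rightarrow> int" where
  "manhattan x y = (\<Sum>i\<in>UNIV. \<bar>x $ i - y $ i\<bar>)"

definition VR_complex :: "('a \<Rightarrow> 'a \<Rightarrow> 'b::linorder) \<Rightarrow> 'a set \<Rightarrow> 'b \<Rightarrow> 'a set set" where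
  "VR_complex d X r = {\<sigma>. \<sigma> \<subseteq> X \<and> finite \<sigma> \<and> \<sigma> \<noteq> {} \<and> (\<forall>x\<in>\<sigma>. \<forall>y\<in>\<sigma>. d x y \<le> r)}"

text \<open>Closed geometric simplex spanned by a finite vertex set, as barycentric
  coordinate functions.\<close>
definition closed_simplex :: "'a set \<Rightarrow> ('a \<Rightarrow> real) set" where
  "closed_simplex \<sigma> = {t. (\<forall>v. 0 \<le> t v) \<and> (\<forall>v. v \<notin> \<sigma> \<longrightarrow> t v = 0) \<and> sum t \<sigma> = 1}"

definition realization_set :: "'a set set \<Rightarrow> ('a \<Rightarrow> real) set" where
  "realization_set K = (\<Union>\<sigma>\<in>K. closed_simplex \<sigma>)"

text \<open>Geometric realization with the weak (coherent) topology: a subset is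
  open iff its intersection with every closed simplex is open in that simplex
  (with its Euclidean topology, here the subspace topology of the product topology).\<close>
definition realization_open :: "'a set set \<Rightarrow> ('a \<Rightarrow> real) set \<Rightarrow> bool" where
  "realization_open K U \<longleftrightarrow> U \<subseteq> realization_set K \<and>
     (\<forall>\<sigma>\<in>K. openin (subtopology (powertop_real UNIV) (closed_simplex \<sigma>)) (U \<inter> closed_simplex \<sigma>))"

lemma realization_openD:
  assumes "realization_open K U" "\<sigma> \<in> K"
  shows "openin (subtopology (powertop_real UNIV) (closed_simplex \<sigma>)) (U \<inter> closed_simplex \<sigma>)"
  using assms unfolding realization_open_def by simp

lemma realization_open_sub:
  assumes "realization_open K U" shows "U \<subseteq> realization_set K"
  using assms unfolding realization_open_def by simp

lemma istopology_realization_open: "istopology (realization_open K)"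
  unfolding istopology_def
proof (intro conjI allI impI)
  fix S T assume S: "realization_open K S" and T: "realization_open K T"
  have "openin (subtopology (powertop_real UNIV) (closed_simplex \<sigma>)) (S \<inter> T \<inter> closed_simplex \<sigma>)"
    if "\<sigma> \<in> K" for \<sigma>
  proof -
    have "S \<inter> T \<inter> closed_simplex \<sigma> = (S \<inter> closed_simplex \<sigma>) \<inter> (T \<inter> closed_simplex \<sigma>)"
      by blast
    then show ?thesis
      using openin_Int[OF realization_openD[OF S that] realization_openD[OF T that]] by simp
  qed
  moreover have "S \<inter> T \<subseteq> realization_set K" using realization_open_sub[OF S] by blast
  ultimately show "realization_open K (S \<inter> T)"
    unfolding realization_open_def by blast
next
  fix \<F> assume F: "Ball \<F> (realization_open K)"
  have "openin (subtopology (powertop_real UNIV) (closed_simplex \<sigma>)) (\<Union>\<F> \<inter> closed_simplex \<sigma>)"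
    if "\<sigma> \<in> K" for \<sigma>
  proof -
    have eq: "\<Union>\<F> \<inter> closed_simplex \<sigma> = \<Union>((\<lambda>U. U \<inter> closed_simplex \<sigma>) ` \<F>)"
      by blast
    have "openin (subtopology (powertop_real UNIV) (closed_simplex \<sigma>)) (\<Union>((\<lambda>U. U \<inter> closed_simplex \<sigma>) ` \<F>))"
    proof (rule openin_Union)
      fix V assume "V \<in> (\<lambda>U. U \<inter> closed_simplex \<sigma>) ` \<F>"
      then obtain U where U: "U \<in> \<F>" and V: "V = U \<inter> closed_simplex \<sigma>" by blast
      have "realization_open K U" using F U by blast
      then show "openin (subtopology (powertop_real UNIV) (closed_simplex \<sigma>)) V"
        unfolding V by (rule realization_openD[OF _ that])
    qed
    then show ?thesis by (simp only: eq)
  qed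
  moreover have "\<Union>\<F> \<subseteq> realization_set K" using F realization_open_sub by blast
  ultimately show "realization_open K (\<Union>\<F>)"
    unfolding realization_open_def by blast
qed

definition geometric_realization :: "'a set set \<Rightarrow> ('a \<Rightarrow> real) topology" where
  "geometric_realization K = topology (realization_open K)"

end

theory Submission
  imports Defs
begin

text \<open>
  The complex is exhausted by the finite Rips complexes of growing boxes, each of which collapses onto
  its predecessor, by removing points one at a time in lexicographic order. If
  \<open>x\<close> is the last point, let \<open>c\<close> be \<open>x\<close> with its first two nonzero coordinates moved by one towards
  \<open>0\<close>. Every other point \<open>z\<close> within distance \<open>r\<close> of \<open>x\<close> is then within \<open>r\<close> of \<open>c\<close>, unless \<open>z\<close> agrees with
  \<open>x\<close> in these two coordinates and has distance \<open>r - 1\<close> or \<open>r\<close> from \<open>x\<close>. Such an exceptional \<open>z\<close> differs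
  from \<open>x\<close> in at most four coordinates, and for \<open>r \<ge> 10\<close> it is dominated, in the link of \<open>x\<close>, by a point
  obtained by moving its largest coordinates (relative to \<open>x\<close>) towards \<open>x\<close>. Removing first the edges from
  \<open>x\<close> to the exceptional points leaves a link that is a cone with apex \<open>c\<close>, so \<open>x\<close> can be removed.
\<close>

subsection \<open>The weak topology\<close>

definition finite_complex :: "'a set set \<Rightarrow> bool" where
  "finite_complex K \<longleftrightarrow> finite K \<and>
     (\<forall>\<tau>\<in>K. finite \<tau> \<and> \<tau> \<noteq> {} \<and> (\<forall>\<rho>. \<rho> \<subseteq> \<tau> \<longrightarrow> \<rho> \<noteq> {} \<longrightarrow> \<rho> \<in> K))"

lemma closed_closed_simplex: "closed (closed_simplex \<sigma>)"
proof (cases "finite \<sigma>")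
  case True
  have "closed_simplex \<sigma> = (\<Inter>v. {t. 0 \<le> t v}) \<inter> (\<Inter>v\<in>-\<sigma>. {t. t v = 0}) \<inter> {t. sum t \<sigma> = 1}"
    unfolding closed_simplex_def by blast
  moreover have "closed {t :: 'a \<Rightarrow> real. 0 \<le> t v}" for v
    by (intro closed_Collect_le continuous_intros continuous_on_product_coordinates)
  moreover have "closed {t :: 'a \<Rightarrow> real. t v = 0}" for v
    by (intro closed_Collect_eq continuous_intros continuous_on_product_coordinates)
  moreover have "closed {t :: 'a \<Rightarrow> real. sum t \<sigma> = 1}"
    by (intro closed_Collect_eq continuous_intros continuous_on_product_coordinates)
  ultimately show ?thesis
    by (auto intro!: closed_Int closed_INT)
next
  case False
  \<comment> \<open>A sum over an infinite set is 0 by convention, so it cannot equal 1.\<close>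
  then have "closed_simplex \<sigma> = {}"
    unfolding closed_simplex_def by simp
  then show ?thesis by simp
qed

lemma openin_geometric_realization:
  "openin (geometric_realization K) = realization_open K"
  unfolding geometric_realization_def using istopology_realization_open by (rule topology_inverse')

lemma realization_open_iff:
  "realization_open K U \<longleftrightarrow> U \<subseteq> realization_set K \<and>
     (\<forall>\<sigma>\<in>K. openin (top_of_set (closed_simplex \<sigma>)) (U \<inter> closed_simplex \<sigma>))"
  unfolding realization_open_def by (simp add: euclidean_product_topology)

lemma topspace_geometric_realization [simp]:
  "topspace (geometric_realization K) = realization_set K"
proof -
  have "realization_set K \<inter> closed_simplex \<sigma> = closed_simplex \<sigma>" if "\<sigma> \<in> K" for \<sigma>
    using that unfolding realization_set_def by blast
  then have "realization_open K (realization_set K)"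
    unfolding realization_open_iff by simp
  then show ?thesis
    by (metis openin_geometric_realization openin_subset openin_topspace realization_open_sub
        subset_antisym)
qed

lemma closed_simplex_subset_realization_set:
  "\<sigma> \<in> K \<Longrightarrow> closed_simplex \<sigma> \<subseteq> realization_set K"
  unfolding realization_set_def by blast

lemma realization_set_mono: "L \<subseteq> K \<Longrightarrow> realization_set L \<subseteq> realization_set K"
  unfolding realization_set_def by blast

text \<open>Complements taken simplex by simplex are closed, and a finite union of them stays
  closed. On a finite subcomplex the weak topology is thus no finer than the product topology, so
  maps continuous for the latter can be used.\<close>

lemma realization_open_finite_subcomplex:
  assumes U: "realization_open K U" and L: "finite L" "L \<subseteq> K"
  shows "openin (top_of_set (realization_set L)) (U \<inter> realization_set L)"
proof -
  have "closedin (top_of_set (closed_simplex \<sigma>)) (closed_simplex \<sigma> - U \<inter> closed_simplex \<sigma>)"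
    if "\<sigma> \<in> L" for \<sigma>
    using U L(2) that unfolding realization_open_iff
    by (metis closedin_diff closedin_topspace topspace_euclidean_subtopology subsetD)
  moreover have "closed_simplex \<sigma> - U \<inter> closed_simplex \<sigma> = closed_simplex \<sigma> - U" for \<sigma>
    by blast
  ultimately have "closed (closed_simplex \<sigma> - U)" if "\<sigma> \<in> L" for \<sigma>
    using closedin_closed_trans[OF _ closed_closed_simplex, of \<sigma>] that by simp
  then have "closed (\<Union>\<sigma>\<in>L. closed_simplex \<sigma> - U)"
    using L(1) by blast
  moreover have "realization_set L - U \<inter> realization_set L = (\<Union>\<sigma>\<in>L. closed_simplex \<sigma> - U)"
    unfolding realization_set_def by blast
  ultimately have "closedin (top_of_set (realization_set L)) (realization_set L - U \<inter> realization_set L)"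
    by (metis closed_subset Diff_subset)
  then show ?thesis
    by (metis Diff_Diff_Int Int_commute Int_lower2 inf.absorb_iff2 openin_diff openin_topspace
        topspace_euclidean_subtopology)
qed

text \<open>The product of the weak topology with the interval is again coherent with the closed
  simplices because the interval is locally compact.\<close>
lemma continuous_map_realization_homotopy:
  assumes cont: "\<And>\<sigma>. \<sigma> \<in> K \<Longrightarrow> continuous_on ({0..1} \<times> closed_simplex \<sigma>) h"
    and fin: "\<And>\<sigma>. \<sigma> \<in> K \<Longrightarrow>
      \<exists>L. finite L \<and> L \<subseteq> K \<and> h ` ({0..1} \<times> closed_simplex \<sigma>) \<subseteq> realization_set L"
  shows "continuous_map (prod_topology (top_of_set {0..1::real}) (geometric_realization K))
           (geometric_realization K) h"
  unfolding continuous_map openin_geometric_realization topspace_prod_topology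
    topspace_euclidean_subtopology topspace_geometric_realization
proof (intro conjI allI impI)
  show "h ` ({0..1} \<times> realization_set K) \<subseteq> realization_set K"
  proof clarify
    fix t :: real and x assume t: "t \<in> {0..1}" and "x \<in> realization_set K"
    then obtain \<sigma> where "\<sigma> \<in> K" "x \<in> closed_simplex \<sigma>"
      unfolding realization_set_def by blast
    then show "h (t, x) \<in> realization_set K"
      using fin[of \<sigma>] t realization_set_mono by blast
  qed
next
  fix U assume U: "realization_open K U"
  define W where "W = {z \<in> {0..1} \<times> realization_set K. h z \<in> U}"
  have W_simplex: "openin (top_of_set ({0..1} \<times> closed_simplex \<sigma>)) (W \<inter> {0..1} \<times> closed_simplex \<sigma>)"
    if \<sigma>: "\<sigma> \<in> K" for \<sigma>
  proof -
    obtain L where L: "finite L" "L \<subseteq> K" "h ` ({0..1} \<times> closed_simplex \<sigma>) \<subseteq> realization_set L"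
      using fin[OF \<sigma>] by blast
    have "openin (top_of_set ({0..1} \<times> closed_simplex \<sigma>))
            ({0..1} \<times> closed_simplex \<sigma> \<inter> h -` (U \<inter> realization_set L))"
      using continuous_openin_preimage[OF cont[OF \<sigma>], of "realization_set L"] L
        realization_open_finite_subcomplex[OF U] by blast
    moreover have "{0..1} \<times> closed_simplex \<sigma> \<inter> h -` (U \<inter> realization_set L)
        = W \<inter> {0..1} \<times> closed_simplex \<sigma>"
      using L(3) closed_simplex_subset_realization_set[OF \<sigma>] unfolding W_def by blast
    ultimately show ?thesis by simp
  qed
  have "\<exists>T. openin (prod_topology (top_of_set {0..1}) (geometric_realization K)) T
            \<and> z \<in> T \<and> T \<subseteq> W" if "z \<in> W" for z
  proof -
    obtain t0 x0 where z: "z = (t0, x0)" by fastforce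
    have t0: "t0 \<in> {0..1}" and x0: "x0 \<in> realization_set K"
      using that z unfolding W_def by auto
    obtain \<sigma> where \<sigma>: "\<sigma> \<in> K" "x0 \<in> closed_simplex \<sigma>"
      using x0 unfolding realization_set_def by blast
    have "openin (top_of_set {0..1})
        ({0..1} \<inter> (\<lambda>t. (t, x0)) -` (W \<inter> {0..1} \<times> closed_simplex \<sigma>))"
      by (rule continuous_openin_preimage[OF _ _ W_simplex[OF \<sigma>(1)]])
        (use \<sigma>(2) in \<open>auto intro: continuous_intros\<close>)
    moreover have "t0 \<in> {0..1} \<inter> (\<lambda>t. (t, x0)) -` (W \<inter> {0..1} \<times> closed_simplex \<sigma>)"
      using that z t0 \<sigma> by blast
    ultimately obtain e where e: "e > 0"
      "cball t0 e \<inter> {0..1} \<subseteq> {0..1} \<inter> (\<lambda>t. (t, x0)) -` (W \<inter> {0..1} \<times> closed_simplex \<sigma>)"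
      unfolding openin_contains_cball by blast
    \<comment> \<open>\<open>J\<close> is a compact neighbourhood of \<open>t0\<close> in the
      interval with \<open>J \<times> {x0}\<close> inside \<open>W\<close>. Its compactness lets the
      tube lemma show that the set \<open>V\<close> of all points with this property is open in each
      closed simplex.\<close>
    define J where "J = cball t0 e \<inter> {0..1}"
    have J: "compactin (top_of_set {0..1}) J"
      unfolding J_def compactin_subtopology by (auto intro: compact_Int)
    define V where "V = {x \<in> realization_set K. J \<times> {x} \<subseteq> W}"
    have "realization_open K V"
      unfolding realization_open_iff
    proof (intro conjI ballI)
      show "V \<subseteq> realization_set K" unfolding V_def by blast
      fix \<tau> assume \<tau>: "\<tau> \<in> K"
      show "openin (top_of_set (closed_simplex \<tau>)) (V \<inter> closed_simplex \<tau>)"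
      proof (subst openin_subopen, intro ballI)
        fix y assume y: "y \<in> V \<inter> closed_simplex \<tau>"
        have "openin (prod_topology (top_of_set {0..1}) (top_of_set (closed_simplex \<tau>)))
            (W \<inter> {0..1} \<times> closed_simplex \<tau>)"
          using W_simplex[OF \<tau>] by simp
        moreover have "J \<times> {y} \<subseteq> W \<inter> {0..1} \<times> closed_simplex \<tau>"
          using y unfolding V_def J_def by blast
        ultimately obtain A B where "openin (top_of_set (closed_simplex \<tau>)) B" "J \<subseteq> A" "y \<in> B"
          and AB: "A \<times> B \<subseteq> W \<inter> {0..1} \<times> closed_simplex \<tau>"
          using tube_lemma_left[OF _ J, of "top_of_set (closed_simplex \<tau>)" _ y] y
          by (metis IntD2 topspace_euclidean_subtopology)
        moreover have "B \<subseteq> V \<inter> closed_simplex \<tau>"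
        proof
          fix b assume "b \<in> B"
          then have "J \<times> {b} \<subseteq> W \<inter> {0..1} \<times> closed_simplex \<tau>"
            using AB \<open>J \<subseteq> A\<close> by blast
          moreover have "t0 \<in> J" using t0 e unfolding J_def by simp
          ultimately show "b \<in> V \<inter> closed_simplex \<tau>"
            using closed_simplex_subset_realization_set[OF \<tau>] unfolding V_def by blast
        qed
        ultimately show "\<exists>T. openin (top_of_set (closed_simplex \<tau>)) T \<and> y \<in> T \<and> T \<subseteq> V \<inter> closed_simplex \<tau>"
          by blast
      qed
    qed
    then have "openin (prod_topology (top_of_set {0..1}) (geometric_realization K))
        (({0..1} \<inter> ball t0 e) \<times> V)"
      by (simp add: openin_prod_Times_iff openin_geometric_realization openin_open_Int)
    moreover have "z \<in> ({0..1} \<inter> ball t0 e) \<times> V"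
      using z t0 x0 e unfolding V_def J_def by auto
    moreover have "({0..1} \<inter> ball t0 e) \<times> V \<subseteq> W"
      unfolding V_def J_def by (auto simp: subset_iff)
    ultimately show ?thesis by blast
  qed
  then show "openin (prod_topology (top_of_set {0..1}) (geometric_realization K))
      {z \<in> {0..1} \<times> realization_set K. h z \<in> U}"
    unfolding W_def[symmetric] by (subst openin_subopen) blast
qed

subsection \<open>Collapses and deformations\<close>

text \<open>The homotopy is continuous on the whole space of coordinate functions, so that such homotopies
  can be composed without regard to the weak topology.\<close>
definition deformation :: "'a set set \<Rightarrow> 'a set set \<Rightarrow> (real \<times> ('a \<Rightarrow> real) \<Rightarrow> 'a \<Rightarrow> real) \<Rightarrow> bool" where
  "deformation K K' f \<longleftrightarrow> continuous_on UNIV f \<and> (\<forall>t. f (0, t) = t) \<and>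
     (\<forall>s\<in>{0..1}. \<forall>t\<in>realization_set K'. f (s, t) = t) \<and>
     (\<forall>s\<in>{0..1}. \<forall>t\<in>realization_set K. f (s, t) \<in> realization_set K) \<and>
     (\<forall>t\<in>realization_set K. f (1, t) \<in> realization_set K')"

text \<open>For a simplex \<open>\<sigma>\<close> of a complex \<open>L\<close>, the condition on
  \<open>w\<close> says that the link of \<open>\<sigma>\<close> is a cone with apex
  \<open>w\<close>. Below, \<open>\<sigma>\<close> is a vertex or an edge, so a step deletes a
  dominated vertex or edge with its open star.\<close>

inductive collapses :: "'a set set \<Rightarrow> 'a set set \<Rightarrow> bool" where
  refl: "collapses K K"
| step: "collapses K {\<tau>\<in>L. \<not> \<sigma> \<subseteq> \<tau>}"
    if "collapses K L" "finite \<sigma>" "\<sigma> \<noteq> {}" "w \<notin> \<sigma>" "\<And>\<tau>. \<tau> \<in> L \<Longrightarrow> \<sigma> \<subseteq> \<tau> \<Longrightarrow> insert w \<tau> \<in> L"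

lemma collapses_trans:
  assumes "collapses L M" "collapses K L" shows "collapses K M"
  using assms
proof (induction rule: collapses.induct)
  case (step L M \<sigma> w)
  then show ?case using collapses.step by metis
qed

lemma collapses_subset: "collapses K L \<Longrightarrow> L \<subseteq> K"
  by (induction rule: collapses.induct) auto

lemma finite_complex_star_removed:
  assumes "finite_complex K"
  shows "finite_complex {\<tau>\<in>K. \<not> \<sigma> \<subseteq> \<tau>}"
  unfolding finite_complex_def
proof (intro conjI ballI allI impI)
  show "finite {\<tau>\<in>K. \<not> \<sigma> \<subseteq> \<tau>}" using assms unfolding finite_complex_def by simp
  fix \<tau> assume \<tau>: "\<tau> \<in> {\<tau>\<in>K. \<not> \<sigma> \<subseteq> \<tau>}"
  then show "finite \<tau>" "\<tau> \<noteq> {}" using assms unfolding finite_complex_def by blast+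
  fix \<rho> assume "\<rho> \<subseteq> \<tau>" "\<rho> \<noteq> {}"
  then show "\<rho> \<in> {\<tau>\<in>K. \<not> \<sigma> \<subseteq> \<tau>}" using assms \<tau> unfolding finite_complex_def by blast
qed

lemma collapses_finite_complex: "collapses K L \<Longrightarrow> finite_complex K \<Longrightarrow> finite_complex L"
proof (induction rule: collapses.induct)
  case (step K L \<sigma> w)
  then have "finite_complex L" by blast
  then show ?case
    by (rule finite_complex_star_removed)
qed

lemma continuous_on_Min_image:
  fixes f :: "'i \<Rightarrow> 'a::topological_space \<Rightarrow> real"
  assumes "finite S" "S \<noteq> {}" "\<And>i. i \<in> S \<Longrightarrow> continuous_on A (f i)"
  shows "continuous_on A (\<lambda>x. Min ((\<lambda>i. f i x) ` S))"
  using assms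
proof (induction rule: finite_ne_induct)
  case (singleton i)
  then show ?case by simp
next
  case (insert i F)
  then have "Min ((\<lambda>i. f i x) ` insert i F) = min (f i x) (Min ((\<lambda>i. f i x) ` F))" for x
    by simp
  then show ?case using insert by (simp add: continuous_on_min)
qed

lemma realization_setI:
  assumes "finite_complex K" "\<tau> \<in> K" "\<And>v. 0 \<le> t v" "{v. t v \<noteq> 0} \<subseteq> \<tau>" "sum t \<tau> = 1"
  shows "t \<in> realization_set K"
proof -
  have "t \<in> closed_simplex \<tau>"
    using assms(3-5) unfolding closed_simplex_def by auto
  then show ?thesis
    using closed_simplex_subset_realization_set[OF assms(2)] by blast
qed

lemma realization_setE:
  assumes "finite_complex K" "t \<in> realization_set K"
  shows "{v. t v \<noteq> 0} \<in> K" "\<And>v. 0 \<le> t v" "sum t {v. t v \<noteq> 0} = 1" "finite {v. t v \<noteq> 0}"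
proof -
  obtain \<tau> where \<tau>: "\<tau> \<in> K" and t: "t \<in> closed_simplex \<tau>"
    using assms(2) unfolding realization_set_def by blast
  have t0: "t v = 0" if "v \<notin> \<tau>" for v using t that unfolding closed_simplex_def by simp
  have t1: "sum t \<tau> = 1" using t unfolding closed_simplex_def by simp
  have sub: "{v. t v \<noteq> 0} \<subseteq> \<tau>" using t0 by blast
  have fin_\<tau>: "finite \<tau>" using assms(1) \<tau> unfolding finite_complex_def by blast
  then show fin: "finite {v. t v \<noteq> 0}" and sm: "sum t {v. t v \<noteq> 0} = 1"
    using sum.mono_neutral_left[OF fin_\<tau> sub, of t] finite_subset[OF sub fin_\<tau>] t1 by auto
  then show "{v. t v \<noteq> 0} \<in> K"
    using assms(1) \<tau> sub unfolding finite_complex_def by (metis sum.empty zero_neq_one)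
  show "0 \<le> t v" for v using t unfolding closed_simplex_def by simp
qed

text \<open>The mass carried in common by the vertices of \<open>\<sigma>\<close> is moved to \<open>w\<close> at unit speed.\<close>
lemma deformation_step:
  assumes L: "finite_complex L" and \<sigma>: "finite \<sigma>" "\<sigma> \<noteq> {}" "w \<notin> \<sigma>"
    and w: "\<And>\<tau>. \<tau> \<in> L \<Longrightarrow> \<sigma> \<subseteq> \<tau> \<Longrightarrow> insert w \<tau> \<in> L"
  shows "\<exists>f. deformation L {\<tau>\<in>L. \<not> \<sigma> \<subseteq> \<tau>} f"
proof -
  \<comment> \<open>At time \<open>s\<close> each vertex of \<open>\<sigma>\<close> has lost
    \<open>s * m t\<close>, and the factor \<open>card \<sigma>\<close> at \<open>w\<close> keeps
    the total equal to 1. At time 1 a vertex attaining the minimum has coordinate 0, so the support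
    no longer contains \<open>\<sigma>\<close>.\<close>
  define m where "m t = Min (t ` \<sigma>)" for t :: "'a \<Rightarrow> real"
  define f where "f = (\<lambda>(s::real, t::'a \<Rightarrow> real) v. t v + s * m t *
      (if v \<in> \<sigma> then -1 else if v = w then real (card \<sigma>) else 0))"
  let ?L' = "{\<tau>\<in>L. \<not> \<sigma> \<subseteq> \<tau>}"
  have L': "finite_complex ?L'"
    by (rule finite_complex_star_removed[OF L])
  have m_le: "m t \<le> t v" if "v \<in> \<sigma>" for t v
    using that \<sigma>(1) unfolding m_def by simp
  have m_attained: "\<exists>v\<in>\<sigma>. t v = m t" for t
    using \<sigma> Min_in[of "t ` \<sigma>"] unfolding m_def by fastforce
  have coord: "continuous_on UNIV (\<lambda>z :: real \<times> ('a \<Rightarrow> real). snd z v)" for v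
    by (rule continuous_on_product_then_coordinatewise[where f = snd]) (rule continuous_on_snd[OF continuous_on_id])
  have cont: "continuous_on UNIV f"
    unfolding f_def case_prod_unfold m_def
    by (intro continuous_on_coordinatewise_then_product continuous_intros coord
        continuous_on_Min_image[OF \<sigma>(1,2)])
  have fixed: "f (s, t) = t" if "t \<in> realization_set ?L'" for s t
  proof -
    have "{v. t v \<noteq> 0} \<in> ?L'" using realization_setE[OF L' that] by blast
    then obtain v where "v \<in> \<sigma>" "t v = 0" by blast
    then have "m t \<le> 0" using m_le by metis
    moreover have "m t \<ge> 0" using m_attained[of t] realization_setE(2)[OF L' that] by metis
    ultimately show ?thesis unfolding f_def by simp
  qed
  have stays: "f (s, t) \<in> realization_set L" and last: "s = 1 \<Longrightarrow> f (s, t) \<in> realization_set ?L'"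
    if s: "s \<in> {0..1}" and t: "t \<in> realization_set L" and ex: "m t \<noteq> 0" for s t
  proof -
    note tE = realization_setE[OF L t]
    let ?S = "{v. t v \<noteq> 0}"
    \<comment> \<open>A nonzero minimum puts all of \<open>\<sigma>\<close> into the support, and
      the hypothesis on \<open>w\<close> then makes the support enlarged by \<open>w\<close> a
      simplex.\<close>
    have mpos: "m t > 0" using ex m_attained[of t] tE(2) by (metis order_le_less)
    then have "\<sigma> \<subseteq> ?S" using m_le[of _ t] by fastforce
    then have inL: "insert w ?S \<in> L" using w tE(1) by blast
    have nonneg: "0 \<le> f (s, t) v" for v
    proof (cases "v \<in> \<sigma>")
      case True
      have "s * m t \<le> 1 * m t" using s mpos by (intro mult_right_mono) auto
      then show ?thesis using True m_le[OF True, of t] unfolding f_def by simp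
    next
      case False
      then show ?thesis using s mpos tE(2)[of v] unfolding f_def by simp
    qed
    have supp: "{v. f (s, t) v \<noteq> 0} \<subseteq> insert w ?S"
      using \<open>\<sigma> \<subseteq> ?S\<close> unfolding f_def by auto
    have total: "sum (f (s, t)) (insert w ?S) = 1"
    proof -
      have "(\<Sum>v\<in>insert w ?S. if v \<in> \<sigma> then -1 else if v = w then real (card \<sigma>) else 0)
          = (\<Sum>v\<in>insert w ?S. (if v \<in> \<sigma> then -1 else 0) + (if v = w then real (card \<sigma>) else 0))"
        using \<sigma>(3) by (intro sum.cong) auto
      also have "\<dots> = 0"
      proof -
        have "insert w ?S \<inter> {v. v \<in> \<sigma>} = \<sigma>" "insert w ?S \<inter> {v. v = w} = {w}"
          using \<open>\<sigma> \<subseteq> ?S\<close> by auto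
        then show ?thesis using tE(4) by (simp add: sum.distrib sum.If_cases)
      qed
      finally have *: "(\<Sum>v\<in>insert w ?S. if v \<in> \<sigma> then -1 else if v = w then real (card \<sigma>) else 0) = 0" .
      have "sum (f (s, t)) (insert w ?S) = sum t (insert w ?S) + s * m t *
          (\<Sum>v\<in>insert w ?S. if v \<in> \<sigma> then -1 else if v = w then real (card \<sigma>) else 0)"
        unfolding f_def by (simp only: case_prod_conv sum.distrib sum_distrib_left)
      also have "\<dots> = sum t ?S"
        unfolding * using tE(4) by (simp add: sum.insert_if)
      finally show ?thesis using tE(3) by simp
    qed
    show "f (s, t) \<in> realization_set L"
      by (rule realization_setI[OF L inL nonneg supp total])
    show "f (s, t) \<in> realization_set ?L'" if "s = 1"
    proof -
      note fE = realization_setE[OF L \<open>f (s, t) \<in> realization_set L\<close>]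
      obtain v where "v \<in> \<sigma>" "t v = m t" using m_attained by blast
      then have "f (s, t) v = 0" unfolding f_def using that by simp
      then have "{v. f (s, t) v \<noteq> 0} \<in> ?L'" using fE(1) \<open>v \<in> \<sigma>\<close> by blast
      then show ?thesis
        using realization_setI[OF L' _ nonneg _ fE(3)] by blast
    qed
  qed
  have zero: "t \<in> realization_set ?L'" if t: "t \<in> realization_set L" and m0: "m t = 0" for t
  proof -
    note tE = realization_setE[OF L t]
    obtain v where "v \<in> \<sigma>" "t v = 0" using m_attained[of t] m0 by metis
    then have "{v. t v \<noteq> 0} \<in> ?L'" using tE(1) by blast
    then show ?thesis
      using realization_setI[OF L' _ tE(2) _ tE(3)] by blast
  qed
  have still: "f (s, t) = t" if "m t = 0" for s t
    using that unfolding f_def by simp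
  have "f (0, t) = t" for t
    unfolding f_def by simp
  moreover have "f (s, t) \<in> realization_set L" if "s \<in> {0..1}" "t \<in> realization_set L" for s t
    using stays still that by (cases "m t = 0") auto
  moreover have "f (1, t) \<in> realization_set ?L'" if "t \<in> realization_set L" for t
    using last[of 1] still zero that by (cases "m t = 0") auto
  ultimately have "deformation L ?L' f"
    unfolding deformation_def using cont fixed by blast
  then show ?thesis by blast
qed

lemma deformation_compose:
  assumes f: "deformation K L f" and g: "deformation L M g"
    and sub: "M \<subseteq> L" "L \<subseteq> K"
  shows "\<exists>h. deformation K M h"
proof -
  \<comment> \<open>The clamped times run \<open>f\<close> on the first half and \<open>g\<close> on
    the second. Since \<open>g\<close> is the identity at time 0, one continuous formula covers both
    halves and nothing has to be pasted at 1/2.\<close>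
  define h where "h = (\<lambda>(s::real, t). g (max 0 (2 * s - 1), f (min 1 (2 * s), t)))"
  have fc: "continuous_on UNIV f" and gc: "continuous_on UNIV g"
    using f g unfolding deformation_def by auto
  have "continuous_on UNIV h"
    unfolding h_def case_prod_unfold
    by (intro continuous_intros continuous_on_compose2[OF gc] continuous_on_compose2[OF fc]) auto
  moreover have "h (s, t) \<in> realization_set K" if "s \<in> {0..1}" "t \<in> realization_set K" for s t
  proof (cases "s \<le> 1/2")
    case True
    then have "max 0 (2 * s - 1) = 0" "min 1 (2 * s) = 2 * s" by auto
    then have "h (s, t) = f (2 * s, t)" using g unfolding h_def deformation_def by simp
    then show ?thesis using f that True unfolding deformation_def by simp
  next
    case False
    then have "h (s, t) = g (2 * s - 1, f (1, t))" unfolding h_def by (simp add: min_def max_def)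
    then show ?thesis using f g that False realization_set_mono[OF sub(2)]
      unfolding deformation_def by auto
  qed
  ultimately have "deformation K M h"
    using f g realization_set_mono[OF sub(1)] realization_set_mono[OF sub(2)]
    unfolding deformation_def by (auto simp: h_def subset_iff)
  then show ?thesis by blast
qed

lemma collapses_deformation:
  assumes "collapses K L" "finite_complex K"
  shows "\<exists>f. deformation K L f"
  using assms
proof (induction rule: collapses.induct)
  case (refl K)
  have "deformation K K snd" unfolding deformation_def by (auto intro: continuous_intros)
  then show ?case by blast
next
  case (step K L \<sigma> w)
  have "finite_complex L" using step collapses_finite_complex by blast
  then obtain g where "deformation L {\<tau>\<in>L. \<not> \<sigma> \<subseteq> \<tau>} g" using deformation_step step by metis
  moreover obtain f where "deformation K L f" using step by blast
  ultimately show ?case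
    using deformation_compose collapses_subset[OF step(1)] by (metis (no_types, lifting) mem_Collect_eq subsetI)
qed

section \<open>Contracting an increasing union of complexes\<close>

text \<open>The \<open>n\<close>-th retraction is performed in the time interval \<open>[1/(n+2), 1/(n+1)]\<close>, so on each
  finite stage only finitely many of them act.\<close>
theorem contractible_space_collapsing_union:
  fixes K :: "nat \<Rightarrow> 'a set set"
  assumes fc: "\<And>n. finite_complex (K n)" and col: "\<And>n. collapses (K (Suc n)) (K n)"
    and K0: "K 0 = {{a}}"
  shows "contractible_space (geometric_realization (\<Union>n. K n))"
proof -
  let ?R = "\<lambda>n. realization_set (K n)"
  have "\<forall>n. \<exists>f. deformation (K (Suc n)) (K n) f"
    using collapses_deformation[OF col fc] by blast
  then obtain D where D: "\<And>n. deformation (K (Suc n)) (K n) (D n)" by metis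
  \<comment> \<open>The clock of the \<open>n\<close>-th retraction: it rises linearly from 0 to 1
    on its interval, whose length is the reciprocal of \<open>(n + 1) * (n + 2)\<close>, and is
    constant elsewhere.\<close>
  define c where "c n s = max 0 (min 1 ((s - 1 / (real n + 2)) * ((real n + 1) * (real n + 2))))"
    for n and s :: real
  have c01: "c n s \<in> {0..1}" for n s unfolding c_def by auto
  have c0: "c n s = 0" if "s \<le> 1 / (real n + 2)" for n s
  proof -
    have "(s - 1 / (real n + 2)) * ((real n + 1) * (real n + 2)) \<le> 0"
      using that by (intro mult_nonpos_nonneg) auto
    then show ?thesis unfolding c_def by simp
  qed
  have c1: "c n s = 1" if "s \<ge> 1 / (real n + 1)" for n s
  proof -
    have "real n + 1 \<noteq> 0" "real n + 2 \<noteq> 0" by auto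
    then have "(1 / (real n + 1) - 1 / (real n + 2)) * ((real n + 1) * (real n + 2)) = 1"
      by (simp only: left_diff_distrib times_divide_eq_left nonzero_mult_div_cancel_left
          nonzero_mult_div_cancel_right mult_1) simp
    moreover have "(s - 1 / (real n + 2)) * ((real n + 1) * (real n + 2))
        \<ge> (1 / (real n + 1) - 1 / (real n + 2)) * ((real n + 1) * (real n + 2))"
      using that by (intro mult_right_mono) auto
    ultimately show ?thesis unfolding c_def by simp
  qed
  \<comment> \<open>\<open>G n\<close> composes the retractions \<open>D 0\<close>, ...,
    \<open>D (n - 1)\<close>. The one of largest index is innermost, because its time interval comes
    first.\<close>
  define G where "G = rec_nat snd (\<lambda>n Gn (s, t). Gn (s, D n (c n s, t)))"
  have G0: "G 0 (s, t) = t" and GS: "G (Suc n) (s, t) = G n (s, D n (c n s, t))" for n s t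
    unfolding G_def by auto
  have Dc: "continuous_on UNIV (D n)" and D0: "D n (0, t) = t"
    and Dfix: "s \<in> {0..1} \<Longrightarrow> x \<in> ?R n \<Longrightarrow> D n (s, x) = x"
    and Dstay: "s \<in> {0..1} \<Longrightarrow> x \<in> ?R (Suc n) \<Longrightarrow> D n (s, x) \<in> ?R (Suc n)"
    and D1: "x \<in> ?R (Suc n) \<Longrightarrow> D n (1, x) \<in> ?R n" for n s t x
    using D[of n] unfolding deformation_def by auto
  have mono: "?R n \<subseteq> ?R m" if "n \<le> m" for n m
    using that by (rule lift_Suc_mono_le[of ?R, rotated]) 
      (intro realization_set_mono collapses_subset col)
  have Gcont: "continuous_on UNIV (G n)" for n
  proof (induction n)
    case 0
    have "G 0 = snd" using G0 by auto
    then show ?case by (auto intro: continuous_intros)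
  next
    case (Suc n)
    have "G (Suc n) = (\<lambda>z. G n (fst z, D n (c n (fst z), snd z)))" using GS by auto
    then show ?case unfolding c_def
      by (simp only:) (intro continuous_intros continuous_on_compose2[OF Suc]
          continuous_on_compose2[OF Dc]; simp)
  qed
  \<comment> \<open>The earliest clock occurring in \<open>G n\<close> is that of
    \<open>D (n - 1)\<close>, which starts at time \<open>1 / (n + 1)\<close>.\<close>
  have Gid: "G n (s, t) = t" if "s \<le> 1 / (real n + 1)" for n s t
    using that
  proof (induction n arbitrary: t)
    case 0
    show ?case by (simp add: G0)
  next
    case (Suc n)
    then have "s \<le> 1 / (real n + 2)" by (simp add: add.commute)
    moreover have "1 / (real n + 2) \<le> 1 / (real n + 1)" by (simp add: frac_le)
    ultimately show ?case using Suc.IH c0 D0 by (simp add: GS)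
  qed
  have Gstay: "G n (s, x) \<in> ?R n" if "x \<in> ?R n" for n s x
    using that
  proof (induction n arbitrary: x)
    case 0
    then show ?case by (simp add: G0)
  next
    case (Suc n)
    show ?case
    \<comment> \<open>Either \<open>D n\<close> has finished and the point has reached stage
      \<open>n\<close>, or the later retractions have not started and only \<open>D n\<close> moves
      it.\<close>
    proof (cases "s \<ge> 1 / (real n + 1)")
      case True
      then show ?thesis using Suc c1 D1 mono[of n "Suc n"] by (auto simp: GS)
    next
      case False
      then show ?thesis using Suc Gid Dstay[OF c01] by (simp add: GS)
    qed
  qed
  have Gend: "G n (1, x) \<in> ?R 0" if "x \<in> ?R n" for n x
    using that
  proof (induction n arbitrary: x)
    case 0
    then show ?case by (simp add: G0)
  next
    case (Suc n)
    then show ?case using c1[of n 1] D1 by (simp add: GS)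
  qed
  have Gagree: "G m (s, x) = G n (s, x)" if "n \<le> m" "x \<in> ?R n" for n m s x
    using that(1)
  proof (induction rule: dec_induct)
    case (step m)
    then show ?case using Dfix[OF c01] mono that by (metis GS subsetD)
  qed simp
  \<comment> \<open>By \<open>Gagree\<close> any stage containing \<open>x\<close> gives the same
    value, because later retractions fix \<open>x\<close>; the least stage is a canonical
    choice.\<close>
  define h where "h = (\<lambda>(s, x). G (LEAST n. x \<in> ?R n) (s, x))"
  have h: "h (s, x) = G n (s, x)" if "x \<in> ?R n" for n s x
    unfolding h_def case_prod_conv
    by (rule Gagree[symmetric]) (use that in \<open>auto intro: Least_le LeastI\<close>)
  let ?K = "\<Union>n. K n"
  have R: "\<exists>n. x \<in> ?R n" if "x \<in> realization_set ?K" for x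
    using that unfolding realization_set_def by blast
  have "continuous_map (prod_topology (top_of_set {0..1}) (geometric_realization ?K))
          (geometric_realization ?K) h"
  proof (rule continuous_map_realization_homotopy)
    fix \<sigma> assume "\<sigma> \<in> ?K"
    then obtain n where n: "\<sigma> \<in> K n" by blast
    then have sub: "closed_simplex \<sigma> \<subseteq> ?R n" by (rule closed_simplex_subset_realization_set)
    show "continuous_on ({0..1} \<times> closed_simplex \<sigma>) h"
    proof (rule continuous_on_eq)
      show "continuous_on ({0..1} \<times> closed_simplex \<sigma>) (G n)"
        using Gcont continuous_on_subset by blast
    qed (use h sub in auto)
    show "\<exists>L. finite L \<and> L \<subseteq> ?K \<and> h ` ({0..1} \<times> closed_simplex \<sigma>) \<subseteq> realization_set L"
    proof (intro exI conjI)
      show "finite (K n)" using fc unfolding finite_complex_def by blast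
      show "h ` ({0..1} \<times> closed_simplex \<sigma>) \<subseteq> ?R n" using h Gstay sub by auto
    qed blast
  qed
  moreover have "h (0, x) = x" if "x \<in> realization_set ?K" for x
    using R[OF that] h Gid by fastforce
  moreover have "h (1, x) = (\<lambda>v. if v = a then 1 else 0)" if "x \<in> realization_set ?K" for x
  proof -
    have "h (1, x) \<in> ?R 0" using R[OF that] h Gend by fastforce
    then show ?thesis by (auto simp: K0 realization_set_def closed_simplex_def)
  qed
  ultimately show ?thesis
    unfolding contractible_space_def
    by (intro exI[of _ "\<lambda>v. if v = a then 1 else 0"], subst homotopic_with) auto
qed

subsection \<open>Shrinking four coordinates\<close>

text \<open>A largest remaining index is chosen repeatedly. Naming all six indices turns sums over
  \<open>UNIV\<close> into explicit ones that linear arithmetic can handle.\<close>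

lemma sorted_four_coordinates:
  fixes p q :: "6" and a :: "6 \<Rightarrow> int"
  assumes "p \<noteq> q"
  obtains i j k l where "\<And>f :: 6 \<Rightarrow> int. sum f UNIV = f p + f q + f i + f j + f k + f l"
    "distinct [p, q, i, j, k, l]" "a i \<ge> a j" "a j \<ge> a k" "a k \<ge> a l"
proof -
  have largest: "\<exists>i\<in>S. \<forall>j\<in>S. a j \<le> a i" if "S \<noteq> {}" for S :: "6 set"
  proof -
    have "Max (a ` S) \<in> a ` S" using that by simp
    then obtain i where "i \<in> S" "a i = Max (a ` S)" by auto
    then show ?thesis by (metis Max_ge finite_code finite_imageI imageI)
  qed
  have card: "card (UNIV - set xs) = 6 - length xs" if "distinct xs" for xs :: "6 list"
    using that by (simp add: card_Diff_subset distinct_card)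
  have nonempty: "UNIV - set xs \<noteq> {}" if "distinct xs" "length xs < 6" for xs :: "6 list"
    using card[OF that(1)] that(2) by (metis card.empty zero_less_diff less_numeral_extra(3))
  obtain i where i: "i \<in> UNIV - set [p, q]" "\<forall>m\<in>UNIV - set [p, q]. a m \<le> a i"
    using largest[OF nonempty[of "[p, q]"]] assms by auto
  obtain j where j: "j \<in> UNIV - set [p, q, i]" "\<forall>m\<in>UNIV - set [p, q, i]. a m \<le> a j"
    using largest[OF nonempty[of "[p, q, i]"]] assms i by auto
  obtain k where k: "k \<in> UNIV - set [p, q, i, j]" "\<forall>m\<in>UNIV - set [p, q, i, j]. a m \<le> a k"
    using largest[OF nonempty[of "[p, q, i, j]"]] assms i j by auto
  obtain l where l: "l \<in> UNIV - set [p, q, i, j, k]"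
    using nonempty[of "[p, q, i, j, k]"] assms i j k by auto
  have dist: "distinct [p, q, i, j, k, l]" using assms i j k l by auto
  have "set [p, q, i, j, k, l] = UNIV"
    using card[OF dist] by (simp add: card_eq_0_iff) blast
  then have "sum f UNIV = f p + f q + f i + f j + f k + f l" for f :: "6 \<Rightarrow> int"
    using sum.distinct_set_conv_list[OF dist, of f] by simp
  then show thesis using that dist i j k l by auto
qed

text \<open>The second alternative occurs if \<open>y\<close> lies beyond \<open>b\<close> as seen from \<open>0\<close>.\<close>
lemma abs_shrink_cases:
  fixes b y :: int
  assumes "b \<noteq> 0"
  shows "\<bar>y - (b - sgn b)\<bar> = \<bar>y - b\<bar> - 1 \<and> \<bar>y\<bar> + \<bar>b\<bar> \<ge> \<bar>y - b\<bar> \<or>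
         \<bar>y - (b - sgn b)\<bar> = \<bar>y - b\<bar> + 1 \<and> \<bar>y\<bar> + \<bar>b\<bar> \<ge> \<bar>y - b\<bar> + 2 * \<bar>b\<bar>"
proof (cases "b > 0")
  case True
  then show ?thesis by (cases "y \<ge> b") simp_all
next
  case False
  then show ?thesis using assms by (cases "y \<le> b") simp_all
qed

text \<open>A move by two can jump over \<open>y = b - sgn b\<close>, which leaves the distance
  unchanged; hence the first alternative is only an inequality.\<close>

lemma abs_shrink2_cases:
  fixes b y :: int
  assumes "\<bar>b\<bar> \<ge> 2"
  shows "\<bar>y - (b - 2 * sgn b)\<bar> \<le> \<bar>y - b\<bar> \<or>
         \<bar>y - (b - 2 * sgn b)\<bar> = \<bar>y - b\<bar> + 2 \<and> \<bar>y\<bar> + \<bar>b\<bar> \<ge> \<bar>y - b\<bar> + 2 * \<bar>b\<bar>"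
proof (cases "b > 0")
  case True
  then have "sgn b = 1" by simp
  with True show ?thesis by (cases "y \<ge> b") linarith+
next
  case False
  then have "b < 0" using assms by linarith
  then have "sgn b = -1" by simp
  with \<open>b < 0\<close> show ?thesis by (cases "y \<le> b") linarith+
qed

lemma abs_shrink:
  fixes b t :: int
  assumes "0 \<le> t" "t \<le> \<bar>b\<bar>"
  shows "\<bar>b - t * sgn b\<bar> = \<bar>b\<bar> - t" "\<bar>b - (b - t * sgn b)\<bar> = t"
proof -
  have "\<bar>b - t * sgn b\<bar> = \<bar>b\<bar> - t \<and> \<bar>b - (b - t * sgn b)\<bar> = t"
    using assms by (cases b "0::int" rule: linorder_cases) simp_all
  then show "\<bar>b - t * sgn b\<bar> = \<bar>b\<bar> - t" "\<bar>b - (b - t * sgn b)\<bar> = t" by auto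
qed

section \<open>Linear inequalities for the three ways of shrinking\<close>

context
  fixes a1 a2 a3 a4 r :: int
  assumes ord: "a1 \<ge> a2" "a2 \<ge> a3" "a3 \<ge> a4" "a4 \<ge> 0"
    and r: "r \<ge> 10" "r - 1 \<le> a1 + a2 + a3 + a4" "a1 + a2 + a3 + a4 \<le> r"
begin

text \<open>Allows a move by one without reaching 0. If \<open>a2 \<le> 1\<close>, then
  \<open>a1 \<le> 4\<close> and the total is at most 7, but it is at least 9.\<close>

lemma second_ge_2:
  assumes "a1 < a2 + a3 + a4 + 2"
  shows "a2 \<ge> 2"
  using ord r assms by linarith

text \<open>From \<open>a2 \<ge> a3\<close> follows \<open>a1 \<le> a4 + 1\<close>. With
  \<open>a4 \<le> 1\<close> the first three numbers would be at most 2 and the total at most 7,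
  below \<open>r - 1\<close>.\<close>

lemma balanced_ge_2:
  assumes "a1 + a2 < a3 + a4 + 2"
  shows "a4 \<ge> 2"
  using ord r assms by linarith

text \<open>Again \<open>a1 \<le> a4 + 1\<close>, while \<open>a2 + a3 \<ge> 4\<close>. So any three
  of the four numbers exceed the remaining one by at least 2.\<close>

lemma balanced_three_heavy:
  assumes "a1 + a2 < a3 + a4 + 2"
  shows "a2 + a3 + a4 \<ge> a1 + 2"
  using ord r assms balanced_ge_2 by linarith

text \<open>The \<open>ai\<close> are the sorted sizes of the coordinates of \<open>u\<close>. In
  the \<open>i\<close>-th of them \<open>yi\<close>, \<open>di\<close>, \<open>ei\<close> are the
  sizes of \<open>v\<close>, \<open>v - u\<close> and \<open>v - w\<close>, and \<open>y\<close> is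
  the share of the two coordinates where \<open>u\<close> vanishes. If the move leads away from
  \<open>v\<close>, adding the hypotheses bounds the old distance by
  \<open>r + a2 + a3 + a4 - a1\<close>, hence by \<open>r - 2\<close>.\<close>

lemma shrink_one_distance:
  assumes "a1 \<ge> a2 + a3 + a4 + 2"
    and "y + y1 + y2 + y3 + y4 \<le> r" "y + d1 + d2 + d3 + d4 \<le> r"
    and "e1 \<le> d1 \<or> e1 = d1 + 2 \<and> y1 + a1 \<ge> d1 + 2 * a1"
    and "y2 + a2 \<ge> d2" "y3 + a3 \<ge> d3" "y4 + a4 \<ge> d4"
  shows "y + e1 + d2 + d3 + d4 \<le> r"
  using ord r assms by linarith

text \<open>The distance grows only if both moves lead away from \<open>v\<close>. Then the old
  distance is at most \<open>r + a3 + a4 - a1 - a2\<close>, hence at most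
  \<open>r - 2\<close>.\<close>

lemma shrink_two_distance:
  assumes "a1 + a2 \<ge> a3 + a4 + 2"
    and "y + y1 + y2 + y3 + y4 \<le> r" "y + d1 + d2 + d3 + d4 \<le> r"
    and "e1 = d1 - 1 \<and> y1 + a1 \<ge> d1 \<or> e1 = d1 + 1 \<and> y1 + a1 \<ge> d1 + 2 * a1"
    and "e2 = d2 - 1 \<and> y2 + a2 \<ge> d2 \<or> e2 = d2 + 1 \<and> y2 + a2 \<ge> d2 + 2 * a2"
    and "y3 + a3 \<ge> d3" "y4 + a4 \<ge> d4"
  shows "y + e1 + e2 + d3 + d4 \<le> r"
  using assms(4,5) by (elim disjE conjE) (use ord r assms(1-3,6-) in linarith)+

text \<open>With at most two moves away from \<open>v\<close> the distance does not grow. Three cost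
  2, which \<open>balanced_three_heavy\<close> pays for; four cost 4, and then the old distance is
  at most \<open>r\<close> minus the total mass.\<close>

lemma shrink_four_distance:
  assumes "a1 + a2 < a3 + a4 + 2"
    and "y + y1 + y2 + y3 + y4 \<le> r" "y + d1 + d2 + d3 + d4 \<le> r"
    and "e1 = d1 - 1 \<and> y1 + a1 \<ge> d1 \<or> e1 = d1 + 1 \<and> y1 + a1 \<ge> d1 + 2 * a1"
    and "e2 = d2 - 1 \<and> y2 + a2 \<ge> d2 \<or> e2 = d2 + 1 \<and> y2 + a2 \<ge> d2 + 2 * a2"
    and "e3 = d3 - 1 \<and> y3 + a3 \<ge> d3 \<or> e3 = d3 + 1 \<and> y3 + a3 \<ge> d3 + 2 * a3"
    and "e4 = d4 - 1 \<and> y4 + a4 \<ge> d4 \<or> e4 = d4 + 1 \<and> y4 + a4 \<ge> d4 + 2 * a4"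
  shows "y + e1 + e2 + e3 + e4 \<le> r"
  using assms(4-7) by (elim disjE conjE)
    (use balanced_three_heavy[OF assms(1)] balanced_ge_2[OF assms(1)] ord r assms(1-3) in linarith)+

end

text \<open>The largest coordinates of \<open>u\<close> are moved towards \<open>0\<close>: the largest one by two, the two
  largest by one, or all four by one, whichever involves enough mass. A vector \<open>v\<close> from which this
  moves away lies beyond \<open>u\<close> in more than half of these coordinates, hence is close to \<open>u\<close>.\<close>
lemma shrinking_dominator:
  fixes u :: "6 \<Rightarrow> int" and r :: int
  assumes pq: "p \<noteq> q" "u p = 0" "u q = 0" and r: "r \<ge> 10"
    and N: "r - 1 \<le> (\<Sum>i\<in>UNIV. \<bar>u i\<bar>)" "(\<Sum>i\<in>UNIV. \<bar>u i\<bar>) \<le> r"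
  obtains w where "\<And>i. \<bar>w i\<bar> + \<bar>u i - w i\<bar> = \<bar>u i\<bar>" "\<And>i. u i \<noteq> 0 \<Longrightarrow> w i \<noteq> 0"
    "(\<Sum>i\<in>UNIV. \<bar>w i\<bar>) \<le> r - 2"
    "\<And>v. (\<Sum>i\<in>UNIV. \<bar>v i\<bar>) \<le> r \<Longrightarrow> (\<Sum>i\<in>UNIV. \<bar>v i - u i\<bar>) \<le> r \<Longrightarrow> (\<Sum>i\<in>UNIV. \<bar>v i - w i\<bar>) \<le> r"
proof -
  note result = that
  obtain i j k l where sm: "\<And>f :: 6 \<Rightarrow> int. sum f UNIV = f p + f q + f i + f j + f k + f l"
    and dist: "distinct [p, q, i, j, k, l]"
    and ord: "\<bar>u i\<bar> \<ge> \<bar>u j\<bar>" "\<bar>u j\<bar> \<ge> \<bar>u k\<bar>" "\<bar>u k\<bar> \<ge> \<bar>u l\<bar>"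
    using sorted_four_coordinates[OF pq(1), of "\<lambda>i. \<bar>u i\<bar>"] by metis
  \<comment> \<open>Reduces the claim to choosing the amounts \<open>t m\<close> of the moves.
    Strictness in the second condition keeps nonzero coordinates nonzero, and a total of at least 2
    brings the norm down to \<open>r - 2\<close>.\<close>
  have w: thesis
    if t: "\<And>m. 0 \<le> t m" "\<And>m. t m = 0 \<or> t m < \<bar>u m\<bar>" "sum t UNIV \<ge> 2"
      and v: "\<And>v. (\<Sum>i\<in>UNIV. \<bar>v i\<bar>) \<le> r \<Longrightarrow> (\<Sum>i\<in>UNIV. \<bar>v i - u i\<bar>) \<le> r \<Longrightarrow>
        (\<Sum>i\<in>UNIV. \<bar>v i - (u i - t i * sgn (u i))\<bar>) \<le> r" for t :: "6 \<Rightarrow> int"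
  proof (rule result[of "\<lambda>m. u m - t m * sgn (u m)"])
    have t_le: "t m \<le> \<bar>u m\<bar>" for m using t(2)[of m] by auto
    show *: "\<bar>u m - t m * sgn (u m)\<bar> + \<bar>u m - (u m - t m * sgn (u m))\<bar> = \<bar>u m\<bar>" for m
      using abs_shrink[OF t(1) t_le, of m] by simp
    show "u m - t m * sgn (u m) \<noteq> 0" if "u m \<noteq> 0" for m
      using abs_shrink(1)[OF t(1) t_le, of m] t(2)[of m] that by auto
    have "(\<Sum>i\<in>UNIV. \<bar>u i - t i * sgn (u i)\<bar>) = (\<Sum>i\<in>UNIV. \<bar>u i\<bar>) - sum t UNIV"
      by (simp add: abs_shrink(1)[OF t(1) t_le] sum_subtractf)
    then show "(\<Sum>i\<in>UNIV. \<bar>u i - t i * sgn (u i)\<bar>) \<le> r - 2" using t(3) N by linarith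
  qed (use v in blast)
  have neq: "i \<noteq> p" "i \<noteq> q" "j \<noteq> p" "j \<noteq> q" "k \<noteq> p" "k \<noteq> q" "l \<noteq> p" "l \<noteq> q"
    "j \<noteq> i" "k \<noteq> i" "l \<noteq> i" "k \<noteq> j" "l \<noteq> j" "i \<noteq> j" "p \<noteq> i" "p \<noteq> j" "q \<noteq> i" "q \<noteq> j" "p \<noteq> q" "q \<noteq> p"
    using dist by auto
  have N': "r - 1 \<le> \<bar>u i\<bar> + \<bar>u j\<bar> + \<bar>u k\<bar> + \<bar>u l\<bar>" "\<bar>u i\<bar> + \<bar>u j\<bar> + \<bar>u k\<bar> + \<bar>u l\<bar> \<le> r"
    using N pq by (simp_all add: sm)
  note mass = ord abs_ge_zero[of "u l"] r N'
  have vI: "\<bar>v p\<bar> + \<bar>v q\<bar> + \<bar>v i\<bar> + \<bar>v j\<bar> + \<bar>v k\<bar> + \<bar>v l\<bar> \<le> r"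
    "\<bar>v p\<bar> + \<bar>v q\<bar> + \<bar>v i - u i\<bar> + \<bar>v j - u j\<bar> + \<bar>v k - u k\<bar> + \<bar>v l - u l\<bar> \<le> r"
    if "(\<Sum>i\<in>UNIV. \<bar>v i\<bar>) \<le> r" "(\<Sum>i\<in>UNIV. \<bar>v i - u i\<bar>) \<le> r" for v :: "6 \<Rightarrow> int"
    using that pq by (simp_all add: sm)
  consider (one) "\<bar>u i\<bar> \<ge> \<bar>u j\<bar> + \<bar>u k\<bar> + \<bar>u l\<bar> + 2"
    | (two) "\<bar>u i\<bar> < \<bar>u j\<bar> + \<bar>u k\<bar> + \<bar>u l\<bar> + 2"
        "\<bar>u i\<bar> + \<bar>u j\<bar> \<ge> \<bar>u k\<bar> + \<bar>u l\<bar> + 2"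
    | (four) "\<bar>u i\<bar> + \<bar>u j\<bar> < \<bar>u k\<bar> + \<bar>u l\<bar> + 2"
    unfolding not_less[symmetric] by blast
  then show thesis
  proof cases
    case one
    then have big: "\<bar>u i\<bar> > 2" using mass by auto
    show thesis
    proof (rule w[of "(\<lambda>_. 0)(i := 2)"])
      fix v :: "6 \<Rightarrow> int"
      assume "(\<Sum>i\<in>UNIV. \<bar>v i\<bar>) \<le> r" "(\<Sum>i\<in>UNIV. \<bar>v i - u i\<bar>) \<le> r"
      note v = vI[OF this]
      have "\<bar>v p\<bar> + \<bar>v q\<bar> + \<bar>v i - (u i - 2 * sgn (u i))\<bar> + \<bar>v j - u j\<bar> + \<bar>v k - u k\<bar> + \<bar>v l - u l\<bar> \<le> r"
        using big by (intro shrink_one_distance[OF mass one v] abs_shrink2_cases abs_triangle_ineq4) simp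
      then show "(\<Sum>m\<in>UNIV. \<bar>v m - (u m - ((\<lambda>_. 0)(i := 2)) m * sgn (u m))\<bar>) \<le> r"
        using pq by (simp add: sm neq)
    qed (use big in \<open>auto simp: sm neq\<close>)
  next
    case two
    then have big: "\<bar>u j\<bar> \<ge> 2" by (intro second_ge_2[OF mass])
    then have big': "\<bar>u i\<bar> \<ge> 2" using ord(1) by (rule order_trans)
    show thesis
    proof (rule w[of "(\<lambda>_. 0)(i := 1, j := 1)"])
      fix v :: "6 \<Rightarrow> int"
      assume "(\<Sum>i\<in>UNIV. \<bar>v i\<bar>) \<le> r" "(\<Sum>i\<in>UNIV. \<bar>v i - u i\<bar>) \<le> r"
      note v = vI[OF this]
      have "\<bar>v p\<bar> + \<bar>v q\<bar> + \<bar>v i - (u i - sgn (u i))\<bar> + \<bar>v j - (u j - sgn (u j))\<bar>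
          + \<bar>v k - u k\<bar> + \<bar>v l - u l\<bar> \<le> r"
        by (rule shrink_two_distance[OF mass two(2) v])
          (use big big' in \<open>intro abs_shrink_cases abs_triangle_ineq4; auto\<close>)+
      then show "(\<Sum>m\<in>UNIV. \<bar>v m - (u m - ((\<lambda>_. 0)(i := 1, j := 1)) m * sgn (u m))\<bar>) \<le> r"
        using pq by (simp add: sm neq)
    qed (use big big' in \<open>auto simp: sm neq\<close>)
  next
    case four
    note big4 = balanced_ge_2(1)[OF mass four]
    note big3 = order_trans[OF big4 ord(3)]
    note big2 = order_trans[OF big3 ord(2)]
    note big1 = order_trans[OF big2 ord(1)]
    show thesis
    proof (rule w[of "(\<lambda>_. 1)(p := 0, q := 0)"])
      fix v :: "6 \<Rightarrow> int"
      assume "(\<Sum>i\<in>UNIV. \<bar>v i\<bar>) \<le> r" "(\<Sum>i\<in>UNIV. \<bar>v i - u i\<bar>) \<le> r"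
      note v = vI[OF this]
      have "\<bar>v p\<bar> + \<bar>v q\<bar> + \<bar>v i - (u i - sgn (u i))\<bar> + \<bar>v j - (u j - sgn (u j))\<bar>
          + \<bar>v k - (u k - sgn (u k))\<bar> + \<bar>v l - (u l - sgn (u l))\<bar> \<le> r"
        by (rule shrink_four_distance[OF mass four v])
          (use big1 big2 big3 big4 in \<open>intro abs_shrink_cases; auto\<close>)+
      then show "(\<Sum>m\<in>UNIV. \<bar>v m - (u m - ((\<lambda>_. 1)(p := 0, q := 0)) m * sgn (u m))\<bar>) \<le> r"
        using pq by (simp add: sm neq)
    next
      fix m
      have "\<bar>u m\<bar> \<ge> 2" if "m \<noteq> p" "m \<noteq> q"
      proof -
        have "m \<in> {i, j, k, l}"
        proof (rule ccontr)
          assume "m \<notin> {i, j, k, l}"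
          \<comment> \<open>For the indicator function of \<open>m\<close> the sum over
            \<open>UNIV\<close> is 1, whereas all six listed terms would be 0.\<close>
          then show False using sm[of "\<lambda>x. if x = m then 1 else 0"] that by (auto split: if_splits)
        qed
        then show ?thesis using big1 big2 big3 big4 by blast
      qed
      then show "((\<lambda>_. 1)(p := 0, q := 0)) m = 0 \<or> ((\<lambda>_. 1)(p := 0, q := 0)) m < \<bar>u m\<bar>"
        by (cases "m = p \<or> m = q") auto
    qed (auto simp: sm neq)
  qed
qed

subsection \<open>Removing lattice points\<close>

lemma insert_in_VR_complex:
  assumes "\<tau> \<in> VR_complex d X r" "w \<in> X" "\<And>v. v \<in> \<tau> \<Longrightarrow> d w v \<le> r" "d w w \<le> r"
    and sym: "\<And>y z. d y z = d z y"
  shows "insert w \<tau> \<in> VR_complex d X r"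
proof -
  have "d v w \<le> r" if "v \<in> \<tau>" for v
    by (subst sym) (rule assms(3)[OF that])
  then show ?thesis using assms(1-4) unfolding VR_complex_def by blast
qed

lemma finite_complex_VR_complex:
  assumes "finite A" shows "finite_complex (VR_complex d A r)"
  unfolding finite_complex_def
proof (intro conjI ballI allI impI)
  show "finite (VR_complex d A r)"
    by (rule finite_subset[of _ "Pow A"]) (use assms in \<open>auto simp: VR_complex_def\<close>)
  fix \<tau> assume \<tau>: "\<tau> \<in> VR_complex d A r"
  then show "finite \<tau>" "\<tau> \<noteq> {}" unfolding VR_complex_def by auto
  fix \<rho> assume "\<rho> \<subseteq> \<tau>" "\<rho> \<noteq> {}"
  then show "\<rho> \<in> VR_complex d A r"
    using \<tau> unfolding VR_complex_def by (auto intro: finite_subset)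
qed

text \<open>The edges from \<open>x\<close> to \<open>E\<close> are removed first; then the link of \<open>x\<close> is a cone with apex \<open>c\<close>.\<close>
lemma collapses_VR_complex_vertex:
  fixes d :: "'a \<Rightarrow> 'a \<Rightarrow> 'b::linorder"
  assumes sym: "\<And>y z. d y z = d z y" and refl: "\<And>y. d y y \<le> r"
    and x: "x \<notin> A" and E: "finite E" "E \<subseteq> A"
    and dom: "\<And>u. u \<in> E \<Longrightarrow> \<exists>w\<in>A - E. d w x \<le> r \<and> (\<forall>v\<in>A. d v x \<le> r \<longrightarrow> d v u \<le> r \<longrightarrow> d w v \<le> r)"
    and c: "c \<in> A - E" "d c x \<le> r" "\<And>v. v \<in> A - E \<Longrightarrow> d v x \<le> r \<Longrightarrow> d c v \<le> r"
  shows "collapses (VR_complex d (insert x A) r) (VR_complex d A r)"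
proof -
  let ?K = "VR_complex d (insert x A) r"
  let ?L = "\<lambda>F. {\<tau>\<in>?K. \<forall>u\<in>F. \<not> {x, u} \<subseteq> \<tau>}"
  have mem: "d y z \<le> r" "y \<noteq> x \<Longrightarrow> y \<in> A" if "\<tau> \<in> ?K" "y \<in> \<tau>" "z \<in> \<tau>" for \<tau> y z
    using that unfolding VR_complex_def by blast+
  have edges: "collapses ?K (?L F)" if "finite F" "F \<subseteq> E" for F
    using that
  proof (induction F rule: finite_induct)
    case empty
    show ?case by (simp add: collapses.refl)
  next
    case (insert u F)
    \<comment> \<open>As \<open>w\<close> lies outside all of \<open>E\<close>, no removed edge
      joins it to \<open>x\<close>, so adding it to a simplex is harmless in whatever order the
      edges are removed.\<close>
    obtain w where w: "w \<in> A - E" "d w x \<le> r"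
      and wv: "\<And>v. v \<in> A \<Longrightarrow> d v x \<le> r \<Longrightarrow> d v u \<le> r \<Longrightarrow> d w v \<le> r"
      using dom insert.prems by (meson insert_subset)
    have "collapses ?K {\<tau> \<in> ?L F. \<not> {x, u} \<subseteq> \<tau>}"
    proof (rule collapses.step)
      show "collapses ?K (?L F)" using insert by blast
      show "w \<notin> {x, u}" using w x insert.prems by auto
      fix \<tau> assume \<tau>: "\<tau> \<in> ?L F" "{x, u} \<subseteq> \<tau>"
      then have \<tau>K: "\<tau> \<in> ?K" and xu: "x \<in> \<tau>" "u \<in> \<tau>" by auto
      have "d w v \<le> r" if "v \<in> \<tau>" for v
        using wv[of v] w(2) mem[OF \<tau>K that] xu by (cases "v = x") auto
      then have "insert w \<tau> \<in> ?K"
        using \<tau>K w by (intro insert_in_VR_complex sym refl) auto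
      then show "insert w \<tau> \<in> ?L F" using \<tau> w insert.prems by auto
    qed auto
    moreover have "{\<tau> \<in> ?L F. \<not> {x, u} \<subseteq> \<tau>} = ?L (insert u F)" by auto
    ultimately show ?case by simp
  qed
  have "collapses ?K {\<tau> \<in> ?L E. \<not> {x} \<subseteq> \<tau>}"
  proof (rule collapses.step)
    show "collapses ?K (?L E)" using edges E(1) by blast
    show "c \<notin> {x}" using c(1) x by auto
    fix \<tau> assume \<tau>: "\<tau> \<in> ?L E" "{x} \<subseteq> \<tau>"
    then have \<tau>K: "\<tau> \<in> ?K" and x\<tau>: "x \<in> \<tau>" by auto
    have "d c v \<le> r" if "v \<in> \<tau>" for v
    proof (cases "v = x")
      case False
      have "v \<notin> E" using \<tau> that by auto
      then show ?thesis using c(3)[of v] mem[OF \<tau>K that] x\<tau> False by auto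
    qed (use c(2) in simp)
    then have "insert c \<tau> \<in> ?K"
      using \<tau>K c by (intro insert_in_VR_complex sym refl) auto
    then show "insert c \<tau> \<in> ?L E" using \<tau> c(1) by auto
  qed auto
  moreover have "{\<tau> \<in> ?L E. \<not> {x} \<subseteq> \<tau>} = VR_complex d A r"
    using x E(2) unfolding VR_complex_def by auto
  ultimately show ?thesis by simp
qed

section \<open>An enumeration of the integers and its boxes\<close>

text \<open>All integers preceding \<open>n\<close> in the enumeration \<open>0, 1, -1, 2, -2, \<dots>\<close> lie on the same side of \<open>n\<close>.\<close>
definition zigzag :: "int \<Rightarrow> nat" where
  "zigzag n = nat (if n > 0 then 2 * n - 1 else - 2 * n)"

lemma zigzag_0 [simp]: "zigzag 0 = 0"
  by (simp add: zigzag_def)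

lemma zigzag_inject [simp]: "zigzag a = zigzag b \<longleftrightarrow> a = b"
proof
  assume "zigzag a = zigzag b"
  then have "(if a > 0 then 2 * a - 1 else - 2 * a) = (if b > 0 then 2 * b - 1 else - 2 * b)"
    unfolding zigzag_def by (subst (asm) eq_nat_nat_iff) auto
  then show "a = b" by (cases "a > 0"; cases "b > 0") (simp_all, presburger+)
qed simp

lemma zigzag_diff_sgn: "b \<noteq> 0 \<Longrightarrow> zigzag (b - sgn b) < zigzag b"
  unfolding zigzag_def by (cases "b > 0") (auto simp: nat_less_iff)

text \<open>A predecessor of \<open>b\<close> lies strictly on the side of \<open>b\<close> that
  faces 0, so one step towards 0 approaches it.\<close>

lemma zigzag_less_dist:
  assumes "zigzag a < zigzag b"
  shows "\<bar>b - sgn b - a\<bar> = \<bar>a - b\<bar> - 1"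
proof (cases "b > 0")
  case True
  then have "a < b" using assms unfolding zigzag_def by (cases "a > 0") (simp_all add: nat_less_eq_zless)
  then show ?thesis using True by simp
next
  case False
  then have "b < 0" using assms unfolding zigzag_def by (cases "b = 0") simp_all
  moreover have "a > b"
    using assms False unfolding zigzag_def by (cases "a > 0") (simp_all add: nat_less_eq_zless)
  ultimately show ?thesis by simp
qed

text \<open>The hypothesis puts \<open>y\<close> between \<open>a\<close> and \<open>b\<close>. As
  \<open>zigzag\<close> increases away from 0 on either side, its maximum on an interval is at an
  endpoint.\<close>

lemma zigzag_between:
  assumes "\<bar>y - b\<bar> + \<bar>a - y\<bar> = \<bar>a - b\<bar>"
  shows "zigzag y \<le> max (zigzag a) (zigzag b)"
proof -
  have "a \<le> y \<and> y \<le> b \<or> b \<le> y \<and> y \<le> a" using assms by linarith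
  then have "zigzag y \<le> zigzag a \<or> zigzag y \<le> zigzag b"
    unfolding zigzag_def by (cases "y > 0") (auto intro!: nat_mono)
  then show ?thesis by auto
qed

lemma zigzag_between_less:
  assumes "\<bar>y - b\<bar> + \<bar>a - y\<bar> = \<bar>a - b\<bar>" "zigzag a < zigzag b" "y \<noteq> b"
  shows "zigzag y < zigzag b"
proof -
  have "zigzag y \<noteq> zigzag b" using assms(3) by simp
  moreover have "zigzag y \<le> zigzag b" using zigzag_between[OF assms(1)] assms(2) by auto
  ultimately show ?thesis by linarith
qed

text \<open>Separate bounds allow growth by one layer at a time: raising \<open>m k\<close> by one
  admits a single new value of the \<open>k\<close>-th coordinate.\<close>

definition zigzag_box :: "('n \<Rightarrow> nat) \<Rightarrow> (int^'n) set" where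
  "zigzag_box m = {z. \<forall>i. zigzag (z $ i) < m i}"

lemma finite_zigzag_box: "finite (zigzag_box (m :: 'n::finite \<Rightarrow> nat))"
proof -
  have "finite {a. zigzag a < k}" for k
  proof (rule finite_subset)
    show "{a. zigzag a < k} \<subseteq> {- int k..int k}" unfolding zigzag_def by (auto split: if_splits)
  qed simp
  then have "finite (Pi\<^sub>E UNIV (\<lambda>i. {a. zigzag a < m i}))"
    by (intro finite_PiE) auto
  moreover have "zigzag_box m \<subseteq> vec_lambda ` (Pi\<^sub>E UNIV (\<lambda>i. {a. zigzag a < m i}))"
  proof
    fix z assume "z \<in> zigzag_box m"
    then have "vec_nth z \<in> Pi\<^sub>E UNIV (\<lambda>i. {a. zigzag a < m i})" unfolding zigzag_box_def by auto
    then show "z \<in> vec_lambda ` (Pi\<^sub>E UNIV (\<lambda>i. {a. zigzag a < m i}))"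
      by (metis imageI vec_nth_inverse)
  qed
  ultimately show ?thesis by (rule finite_surj)
qed

section \<open>Lexicographic order on lattice points\<close>

text \<open>Smaller rank \<open>\<rho>\<close> means higher priority. The ranking is a parameter
  because the coordinate in which a box grows has to come first.\<close>

definition lex_less :: "('n \<Rightarrow> nat) \<Rightarrow> int^'n \<Rightarrow> int^'n \<Rightarrow> bool" where
  "lex_less \<rho> z x \<longleftrightarrow> (\<exists>j. zigzag (z $ j) < zigzag (x $ j) \<and> (\<forall>i. \<rho> i < \<rho> j \<longrightarrow> z $ i = x $ i))"

lemma lex_less_irrefl: "\<not> lex_less \<rho> z z"
  unfolding lex_less_def by simp

lemma lex_less_trans:
  assumes inj: "inj \<rho>" and zy: "lex_less \<rho> z y" and yx: "lex_less \<rho> y x"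
  shows "lex_less \<rho> z x"
proof -
  obtain j where j: "zigzag (z $ j) < zigzag (y $ j)" "\<And>i. \<rho> i < \<rho> j \<Longrightarrow> z $ i = y $ i"
    using zy unfolding lex_less_def by blast
  obtain k where k: "zigzag (y $ k) < zigzag (x $ k)" "\<And>i. \<rho> i < \<rho> k \<Longrightarrow> y $ i = x $ i"
    using yx unfolding lex_less_def by blast
  consider "\<rho> j < \<rho> k" | "j = k" | "\<rho> k < \<rho> j"
    using inj by (metis injD linorder_less_linear)
  then show ?thesis
  proof cases
    case 1
    then show ?thesis unfolding lex_less_def using j k by (intro exI[of _ j]) auto
  next
    case 2
    then show ?thesis unfolding lex_less_def using j k by (intro exI[of _ j]) auto
  next
    case 3
    then show ?thesis unfolding lex_less_def using j k by (intro exI[of _ k]) auto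
  qed
qed

lemma ex_rank_minimal:
  fixes \<rho> :: "'n::finite \<Rightarrow> nat"
  assumes "P \<noteq> {}"
  obtains p where "p \<in> P" "\<And>j. j \<in> P \<Longrightarrow> \<rho> p \<le> \<rho> j"
proof -
  have "Min (\<rho> ` P) \<in> \<rho> ` P" using assms by simp
  then obtain p where "p \<in> P" "\<rho> p = Min (\<rho> ` P)" by auto
  then show thesis using that by simp
qed

lemma lex_less_total:
  fixes z x :: "int^'n::finite"
  assumes "z \<noteq> x"
  shows "lex_less \<rho> z x \<or> lex_less \<rho> x z"
proof -
  have "{i. z $ i \<noteq> x $ i} \<noteq> {}" using assms by (auto simp: vec_eq_iff)
  then obtain j where j: "z $ j \<noteq> x $ j" "\<And>i. z $ i \<noteq> x $ i \<Longrightarrow> \<rho> j \<le> \<rho> i"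
    using ex_rank_minimal[of "{i. z $ i \<noteq> x $ i}" \<rho>] by auto
  then have "zigzag (z $ j) < zigzag (x $ j) \<or> zigzag (x $ j) < zigzag (z $ j)"
    by (metis linorder_neqE_nat zigzag_inject)
  moreover have "z $ i = x $ i" if "\<rho> i < \<rho> j" for i using j(2)[of i] that by fastforce
  ultimately show ?thesis unfolding lex_less_def by metis
qed

lemma manhattan_commute: "manhattan x y = manhattan y x"
  unfolding manhattan_def by (simp add: abs_minus_commute)

lemma manhattan_self [simp]: "manhattan x x = 0"
  unfolding manhattan_def by simp

definition toward_origin :: "'n set \<Rightarrow> int^'n \<Rightarrow> int^'n" where
  "toward_origin S x = (\<chi> i. if i \<in> S then x $ i - sgn (x $ i) else x $ i)"

lemma toward_origin_nth:
  "toward_origin S x $ i = (if i \<in> S then x $ i - sgn (x $ i) else x $ i)"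
  unfolding toward_origin_def by simp

lemma toward_origin_in_predecessors:
  assumes "x \<in> zigzag_box m" "p \<in> S" "\<And>i. i \<in> S \<Longrightarrow> x $ i \<noteq> 0 \<and> \<rho> p \<le> \<rho> i"
  shows "toward_origin S x \<in> {z \<in> zigzag_box m. lex_less \<rho> z x}"
proof -
  have "zigzag (toward_origin S x $ i) \<le> zigzag (x $ i)" for i
    using zigzag_diff_sgn[of "x $ i"] assms(3)[of i] by (auto simp: toward_origin_nth)
  then have "toward_origin S x \<in> zigzag_box m"
    using assms(1) unfolding zigzag_box_def by (auto intro: le_less_trans)
  moreover have "lex_less \<rho> (toward_origin S x) x"
    unfolding lex_less_def
  proof (intro exI conjI allI impI)
    show "zigzag (toward_origin S x $ p) < zigzag (x $ p)"
      using zigzag_diff_sgn assms(2,3) by (simp add: toward_origin_nth)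
    show "toward_origin S x $ i = x $ i" if "\<rho> i < \<rho> p" for i
      using assms(3)[of i] that by (auto simp: toward_origin_nth)
  qed
  ultimately show ?thesis by blast
qed

section \<open>Removing the last lattice point\<close>

lemma collapses_VR_predecessors:
  fixes x :: "int^6"
  assumes inj: "inj \<rho>" and r: "r \<ge> 10" and x: "x \<in> zigzag_box m"
    and ne: "{z \<in> zigzag_box m. lex_less \<rho> z x} \<noteq> {}"
  shows "collapses (VR_complex manhattan (insert x {z \<in> zigzag_box m. lex_less \<rho> z x}) r)
    (VR_complex manhattan {z \<in> zigzag_box m. lex_less \<rho> z x} r)"
proof -
  define A where "A = {z \<in> zigzag_box m. lex_less \<rho> z x}"
  define P where "P = {j. x $ j \<noteq> 0}"
  have finA: "finite A" unfolding A_def by (rule finite_subset[OF _ finite_zigzag_box]) blast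
  have xA: "x \<notin> A" unfolding A_def using lex_less_irrefl by blast
  \<comment> \<open>Nothing precedes 0 in the enumeration, so a coordinate at which \<open>z\<close>
    comes before \<open>x\<close> is nonzero in \<open>x\<close>.\<close>
  have lead: "\<exists>j\<in>P. zigzag (z $ j) < zigzag (x $ j) \<and> (\<forall>i. \<rho> i < \<rho> j \<longrightarrow> z $ i = x $ i)"
    if z: "z \<in> A" for z
  proof -
    obtain j where j: "zigzag (z $ j) < zigzag (x $ j)" "\<forall>i. \<rho> i < \<rho> j \<longrightarrow> z $ i = x $ i"
      using z unfolding A_def lex_less_def by blast
    have "x $ j \<noteq> 0"
    proof
      assume "x $ j = 0"
      then show False using j(1) by simp
    qed
    then have "j \<in> P" unfolding P_def by simp
    with j show ?thesis by (intro bexI[of _ j] conjI)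
  qed
  have "P \<noteq> {}" using ne lead unfolding A_def by blast
  then obtain p where p: "p \<in> P" "\<And>j. j \<in> P \<Longrightarrow> \<rho> p \<le> \<rho> j"
    using ex_rank_minimal[of P \<rho>] by blast
  have lead_p: "zigzag (z $ p) < zigzag (x $ p)" if z: "z \<in> A" and "z $ p \<noteq> x $ p" for z
  proof -
    obtain j where j: "j \<in> P" "zigzag (z $ j) < zigzag (x $ j)" "\<forall>i. \<rho> i < \<rho> j \<longrightarrow> z $ i = x $ i"
      using lead[OF z] by blast
    have "\<not> \<rho> p < \<rho> j" using j(3) that(2) by blast
    then have "\<rho> p = \<rho> j" using p(2)[OF j(1)] by simp
    then have "p = j" by (rule injD[OF inj])
    then show ?thesis using j(2) by simp
  qed
  have sum_p: "sum f UNIV = f p + sum f (UNIV - {p})" for f :: "6 \<Rightarrow> int"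
    by (simp add: sum.remove)
  have sgn_p: "\<bar>sgn (x $ p)\<bar> = 1" using p(1) unfolding P_def by (simp add: abs_sgn_eq)
  show ?thesis
    unfolding A_def[symmetric]
  proof (cases "P = {p}")
    \<comment> \<open>With only one nonzero coordinate, \<open>c\<close> is closer than
      \<open>x\<close> to every predecessor, and no edge has to be removed first.\<close>
    case True
    define c where "c = toward_origin {p} x"
    have c: "c \<in> A" unfolding c_def A_def
      by (rule toward_origin_in_predecessors[OF x, of p]) (use p P_def in auto)
    have rest: "(\<Sum>i\<in>UNIV - {p}. \<bar>c $ i - v $ i\<bar>) = (\<Sum>i\<in>UNIV - {p}. \<bar>v $ i - x $ i\<bar>)" for v
      unfolding c_def by (intro sum.cong) (auto simp: toward_origin_nth abs_minus_commute)
    have dist: "manhattan c v = manhattan v x - 1" if "v \<in> A" for v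
    proof -
      have "v $ p \<noteq> x $ p" using lead[OF that] True by auto
      then have "\<bar>c $ p - v $ p\<bar> = \<bar>v $ p - x $ p\<bar> - 1"
        using zigzag_less_dist[OF lead_p[OF that]] unfolding c_def by (simp add: toward_origin_nth)
      then show ?thesis unfolding manhattan_def sum_p rest by simp
    qed
    have "manhattan c x = 1"
      unfolding manhattan_def sum_p rest using sgn_p unfolding c_def by (simp add: toward_origin_nth)
    then show "collapses (VR_complex manhattan (insert x A) r) (VR_complex manhattan A r)"
      by (intro collapses_VR_complex_vertex[where E = "{}" and c = c] manhattan_commute xA)
        (use r c dist in auto)
  next
    case False
    then have "P - {p} \<noteq> {}" using p(1) by blast
    then obtain q where q: "q \<in> P - {p}" "\<And>j. j \<in> P - {p} \<Longrightarrow> \<rho> q \<le> \<rho> j"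
      using ex_rank_minimal[of "P - {p}" \<rho>] by blast
    have lead_q: "zigzag (z $ q) < zigzag (x $ q)"
      if z: "z \<in> A" and "z $ p = x $ p" "z $ q \<noteq> x $ q" for z
    proof -
      obtain j where j: "j \<in> P" "zigzag (z $ j) < zigzag (x $ j)" "\<forall>i. \<rho> i < \<rho> j \<longrightarrow> z $ i = x $ i"
        using lead[OF z] by blast
      have "j \<noteq> p" using j(2) that(2) by auto
      then have "\<rho> q \<le> \<rho> j" using q(2) j(1) by blast
      moreover have "\<not> \<rho> q < \<rho> j" using j(3) that(3) by blast
      ultimately have "\<rho> q = \<rho> j" by simp
      then have "q = j" by (rule injD[OF inj])
      then show ?thesis using j(2) by simp
    qed
    have sum_pq: "sum f UNIV = f p + f q + sum f (UNIV - {p, q})" for f :: "6 \<Rightarrow> int"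
    proof -
      have "sum f (UNIV - {p}) = f q + sum f (UNIV - {p} - {q})"
        using q(1) by (intro sum.remove) auto
      moreover have "UNIV - {p} - {q} = UNIV - {p, q}" by blast
      ultimately show ?thesis by (simp add: sum_p)
    qed
    have sgn_q: "\<bar>sgn (x $ q)\<bar> = 1" using q(1) unfolding P_def by (simp add: abs_sgn_eq)
    define c where "c = toward_origin {p, q} x"
    \<comment> \<open>A point agreeing with \<open>x\<close> at \<open>p\<close> and
      \<open>q\<close> is farther from \<open>c\<close> than from \<open>x\<close> by exactly 2, so
      it leaves the range of \<open>c\<close> just when its distance from \<open>x\<close> is
      \<open>r - 1\<close> or \<open>r\<close>.\<close>
    define E where "E = {z \<in> A. r - 1 \<le> manhattan z x \<and> manhattan z x \<le> r \<and> z $ p = x $ p \<and> z $ q = x $ q}"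
    have c: "c \<in> A" unfolding c_def A_def
      by (rule toward_origin_in_predecessors[OF x, of p]) (use p q P_def in auto)
    have c_p: "c $ p = x $ p - sgn (x $ p)" and c_q: "c $ q = x $ q - sgn (x $ q)"
      unfolding c_def by (simp_all add: toward_origin_nth)
    have rest: "(\<Sum>i\<in>UNIV - {p, q}. \<bar>c $ i - v $ i\<bar>) = (\<Sum>i\<in>UNIV - {p, q}. \<bar>v $ i - x $ i\<bar>)" for v
      unfolding c_def by (intro sum.cong) (auto simp: toward_origin_nth abs_minus_commute)
    have "c $ p \<noteq> x $ p" using sgn_p unfolding c_p by linarith
    then have cE: "c \<notin> E" unfolding E_def by blast
    have cx: "manhattan c x = 2"
      unfolding manhattan_def sum_pq rest using sgn_p sgn_q by (simp add: c_p c_q)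
    have cone: "manhattan c v \<le> r" if v: "v \<in> A - E" "manhattan v x \<le> r" for v
    proof -
      have step: "\<bar>c $ p - v $ p\<bar> \<le> \<bar>v $ p - x $ p\<bar> + 1" "\<bar>c $ q - v $ q\<bar> \<le> \<bar>v $ q - x $ q\<bar> + 1"
        using sgn_p sgn_q unfolding c_p c_q by linarith+
      have vA: "v \<in> A" using v by blast
      \<comment> \<open>A coordinate \<open>p\<close> or \<open>q\<close> decided in favour of
        \<open>v\<close> gains 1, which makes up for the loss of at most 1 in the other.\<close>
      consider "v $ p \<noteq> x $ p" | "v $ p = x $ p" "v $ q \<noteq> x $ q" | "v $ p = x $ p" "v $ q = x $ q"
        by blast
      then have "manhattan c v \<le> manhattan v x \<or> manhattan c v \<le> manhattan v x + 2 \<and> manhattan v x < r - 1"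
      proof cases
        case 1
        then have "\<bar>c $ p - v $ p\<bar> = \<bar>v $ p - x $ p\<bar> - 1"
          using zigzag_less_dist[OF lead_p[OF vA]] unfolding c_p by simp
        then show ?thesis using step(2) unfolding manhattan_def sum_pq rest by linarith
      next
        case 2
        then have "\<bar>c $ q - v $ q\<bar> = \<bar>v $ q - x $ q\<bar> - 1"
          using zigzag_less_dist[OF lead_q[OF vA]] unfolding c_q by simp
        then show ?thesis using step(1) unfolding manhattan_def sum_pq rest by linarith
      next
        case 3
        then have "manhattan v x < r - 1" using v unfolding E_def by auto
        moreover have "manhattan c v \<le> manhattan v x + 2"
          using step unfolding manhattan_def sum_pq rest by linarith
        ultimately show ?thesis by blast
      qed
      then show ?thesis using v(2) by linarith
    qed
    have dom: "\<exists>w\<in>A - E. manhattan w x \<le> r \<and>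
        (\<forall>v\<in>A. manhattan v x \<le> r \<longrightarrow> manhattan v u \<le> r \<longrightarrow> manhattan w v \<le> r)"
      if u: "u \<in> E" for u
    proof -
      \<comment> \<open>Moving \<open>x\<close> to the origin puts the exceptional point in the form
        required by \<open>shrinking_dominator\<close>.\<close>
      define U where "U i = u $ i - x $ i" for i
      have uA: "u \<in> A" and UN: "r - 1 \<le> (\<Sum>i\<in>UNIV. \<bar>U i\<bar>)" "(\<Sum>i\<in>UNIV. \<bar>U i\<bar>) \<le> r"
        and Upq: "U p = 0" "U q = 0"
        using u unfolding E_def U_def manhattan_def by auto
      have pq: "p \<noteq> q" using q(1) by blast
      obtain w where
        between: "\<And>i. \<bar>w i\<bar> + \<bar>U i - w i\<bar> = \<bar>U i\<bar>" and nz: "\<And>i. U i \<noteq> 0 \<Longrightarrow> w i \<noteq> 0"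
        and small: "(\<Sum>i\<in>UNIV. \<bar>w i\<bar>) \<le> r - 2"
        and near: "\<And>v. (\<Sum>i\<in>UNIV. \<bar>v i\<bar>) \<le> r \<Longrightarrow> (\<Sum>i\<in>UNIV. \<bar>v i - U i\<bar>) \<le> r \<Longrightarrow> (\<Sum>i\<in>UNIV. \<bar>v i - w i\<bar>) \<le> r"
        by (rule shrinking_dominator[OF pq Upq r UN]) (rule that)
      define z where "z = (\<chi> i. x $ i + w i)"
      have z: "z $ i = x $ i + w i" for i unfolding z_def by simp
      have zb: "\<bar>z $ i - x $ i\<bar> + \<bar>u $ i - z $ i\<bar> = \<bar>u $ i - x $ i\<bar>" for i
        using between[of i] unfolding U_def z by (simp add: algebra_simps)
      have "zigzag (z $ i) < m i" for i
      proof -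
        have "zigzag (u $ i) < m i" "zigzag (x $ i) < m i"
          using x uA unfolding A_def zigzag_box_def by auto
        then show ?thesis using zigzag_between[OF zb[of i]] by simp
      qed
      then have "z \<in> zigzag_box m" unfolding zigzag_box_def by blast
      moreover have "lex_less \<rho> z x"
      proof -
        obtain j where j: "zigzag (u $ j) < zigzag (x $ j)" "\<And>i. \<rho> i < \<rho> j \<Longrightarrow> u $ i = x $ i"
          using lead[OF uA] by blast
        \<comment> \<open>Since \<open>w\<close> kept every nonzero coordinate, \<open>z\<close>
          still differs from \<open>x\<close> at the deciding coordinate \<open>j\<close>; lying
          between \<open>x\<close> and \<open>u\<close> there, it still precedes
          \<open>x\<close>.\<close>
        have "U j \<noteq> 0" using j(1) unfolding U_def by auto
        then have "z $ j \<noteq> x $ j" using nz unfolding z by simp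
        then have "zigzag (z $ j) < zigzag (x $ j)"
          using zigzag_between_less[OF zb j(1)] by blast
        moreover have "z $ i = x $ i" if "\<rho> i < \<rho> j" for i
          using between[of i] j(2)[OF that] unfolding U_def z by simp
        ultimately show ?thesis unfolding lex_less_def by blast
      qed
      ultimately have zA: "z \<in> A" unfolding A_def by blast
      have zx: "manhattan z x \<le> r - 2" using small unfolding manhattan_def z by simp
      moreover have "manhattan z v \<le> r" if "manhattan v x \<le> r" "manhattan v u \<le> r" for v
      proof -
        have "(\<Sum>i\<in>UNIV. \<bar>(v $ i - x $ i) - w i\<bar>) \<le> r"
          by (rule near) (use that in \<open>simp_all add: manhattan_def U_def\<close>)
        then show ?thesis
          unfolding manhattan_commute[of z] unfolding manhattan_def z by (simp add: algebra_simps)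
      qed
      moreover have "z \<notin> E" using zx unfolding E_def by auto
      ultimately show ?thesis using zA by (intro bexI[of _ z]) auto
    qed
    have EA: "E \<subseteq> A" unfolding E_def by blast
    show "collapses (VR_complex manhattan (insert x A) r) (VR_complex manhattan A r)"
      by (rule collapses_VR_complex_vertex[where E = E and c = c, OF manhattan_commute _ xA _ _ dom _ _ cone])
        (use r c cE cx finite_subset[OF EA finA] EA in auto)
  qed
qed

section \<open>From single points to layers, boxes and the whole lattice\<close>

text \<open>Both sets are initial segments of the box, so as long as they differ, the last point of
  \<open>A\<close> lies outside \<open>B\<close> and its removal leaves an initial segment. As
  \<open>B\<close> is nonempty, that point has a predecessor.\<close>

lemma collapses_VR_lex_segment:
  fixes A B :: "(int^6) set"
  assumes inj: "inj \<rho>" and r: "r \<ge> 10" and A: "A \<subseteq> zigzag_box m" and B: "B \<subseteq> A" "B \<noteq> {}"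
    and A_closed: "\<And>x z. x \<in> A \<Longrightarrow> z \<in> zigzag_box m \<Longrightarrow> lex_less \<rho> z x \<Longrightarrow> z \<in> A"
    and B_closed: "\<And>x z. x \<in> B \<Longrightarrow> z \<in> zigzag_box m \<Longrightarrow> lex_less \<rho> z x \<Longrightarrow> z \<in> B"
  shows "collapses (VR_complex manhattan A r) (VR_complex manhattan B r)"
proof -
  have "finite A" using A finite_zigzag_box by (rule finite_subset)
  then show ?thesis using A B A_closed
  proof (induction A rule: finite_psubset_induct)
    case (psubset A)
    show ?case
    proof (cases "A = B")
      case True
      then show ?thesis by (simp add: collapses.refl)
    next
      case False
      have "\<exists>x\<in>A. \<forall>y\<in>A. y \<noteq> x \<longrightarrow> \<not> lex_less \<rho> x y"
      proof (rule Finite_Set.bex_max_element[OF psubset.hyps(1)])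
        show "asymp_on A (lex_less \<rho>)"
          using lex_less_trans[OF inj] lex_less_irrefl by (metis asymp_onI)
        show "transp_on A (lex_less \<rho>)"
          using lex_less_trans[OF inj] by (metis transp_onI)
        show "A \<noteq> {}" using psubset.prems by blast
      qed
      then obtain x where x: "x \<in> A" and max: "\<And>y. y \<in> A \<Longrightarrow> y \<noteq> x \<Longrightarrow> lex_less \<rho> y x"
        using lex_less_total by blast
      have xbox: "x \<in> zigzag_box m" using x psubset.prems by blast
      have xB: "x \<notin> B"
      proof
        assume "x \<in> B"
        then have "A \<subseteq> B" using max B_closed psubset.prems(1) by blast
        then show False using False psubset.prems(2) by blast
      qed
      have eq: "{z \<in> zigzag_box m. lex_less \<rho> z x} = A - {x}"
        using max psubset.prems(1) psubset.prems(4)[OF x] lex_less_irrefl by blast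
      have "collapses (VR_complex manhattan (insert x (A - {x})) r) (VR_complex manhattan (A - {x}) r)"
        using collapses_VR_predecessors[OF inj r xbox] psubset.prems xB unfolding eq by blast
      then have "collapses (VR_complex manhattan A r) (VR_complex manhattan (A - {x}) r)"
        using x by (simp add: insert_absorb)
      moreover have "collapses (VR_complex manhattan (A - {x}) r) (VR_complex manhattan B r)"
      proof (rule psubset.IH)
        show "A - {x} \<subset> A" using x by blast
        show "z \<in> A - {x}" if "y \<in> A - {x}" "z \<in> zigzag_box m" "lex_less \<rho> z y" for y z
          using that max psubset.prems(4) lex_less_trans[OF inj] lex_less_irrefl by blast
      qed (use psubset.prems xB in auto)
      ultimately show ?thesis by (rule collapses_trans[rotated])
    qed
  qed
qed

lemma collapses_VR_box_Suc:
  fixes m :: "6 \<Rightarrow> nat"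
  assumes r: "r \<ge> 10" and m: "\<And>i. 0 < m i"
  shows "collapses (VR_complex manhattan (zigzag_box (m(k := Suc (m k)))) r) (VR_complex manhattan (zigzag_box m) r)"
proof -
  obtain f :: "6 \<Rightarrow> nat" where f: "inj f"
    using finite_imp_inj_to_nat_seg[of "UNIV :: 6 set"] by auto
  \<comment> \<open>With \<open>k\<close> ranked first, every point of the new layer comes after
    every point of the old box, which is therefore an initial segment.\<close>
  define \<rho> where "\<rho> i = (if i = k then 0 else Suc (f i))" for i
  have inj: "inj \<rho>" using f unfolding \<rho>_def inj_def by auto
  show ?thesis
  proof (rule collapses_VR_lex_segment[OF inj r order_refl])
    show "zigzag_box m \<subseteq> zigzag_box (m(k := Suc (m k)))" unfolding zigzag_box_def by (auto intro: less_SucI)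
    have "0 \<in> zigzag_box m" unfolding zigzag_box_def using m by simp
    then show "zigzag_box m \<noteq> {}" by blast
    fix x z assume x: "x \<in> zigzag_box m" and z: "z \<in> zigzag_box (m(k := Suc (m k)))" and "lex_less \<rho> z x"
    then obtain j where j: "zigzag (z $ j) < zigzag (x $ j)" "\<And>i. \<rho> i < \<rho> j \<Longrightarrow> z $ i = x $ i"
      unfolding lex_less_def by blast
    have "zigzag (z $ k) \<le> zigzag (x $ k)"
      using j by (cases "j = k") (auto simp: \<rho>_def)
    moreover have "zigzag (x $ k) < m k" using x unfolding zigzag_box_def by blast
    ultimately have "zigzag (z $ k) < m k" by linarith
    moreover have "zigzag (z $ i) < m i" if "i \<noteq> k" for i
      using z that unfolding zigzag_box_def by (metis (mono_tags, lifting) fun_upd_other mem_Collect_eq)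
    ultimately have "zigzag (z $ i) < m i" for i
      by (cases "i = k") auto
    then show "z \<in> zigzag_box m" unfolding zigzag_box_def by blast
  qed
qed

text \<open>The cube grows one coordinate at a time; \<open>S\<close> is the set of coordinates
  already enlarged.\<close>

lemma collapses_VR_cube_Suc:
  assumes r: "r \<ge> 10"
  shows "collapses (VR_complex manhattan (zigzag_box (\<lambda>_ :: 6. Suc (Suc n))) r)
    (VR_complex manhattan (zigzag_box (\<lambda>_. Suc n)) r)"
proof -
  have "collapses (VR_complex manhattan (zigzag_box (\<lambda>i :: 6. if i \<in> S then Suc (Suc n) else Suc n)) r)
    (VR_complex manhattan (zigzag_box (\<lambda>_. Suc n)) r)" if "finite S" for S
    using that
  proof (induction S rule: finite_induct)
    case empty
    show ?case by (simp add: collapses.refl)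
  next
    case (insert k S)
    let ?m = "\<lambda>i. if i \<in> S then Suc (Suc n) else Suc n"
    have "(\<lambda>i. if i \<in> insert k S then Suc (Suc n) else Suc n) = ?m(k := Suc (?m k))"
      using insert.hyps(2) by auto
    moreover have "collapses (VR_complex manhattan (zigzag_box (?m(k := Suc (?m k)))) r)
        (VR_complex manhattan (zigzag_box ?m) r)"
      by (rule collapses_VR_box_Suc[OF r]) simp
    ultimately show ?case using collapses_trans[OF insert.IH] by simp
  qed
  from this[of UNIV] show ?thesis by simp
qed

theorem theorem3p13:
  fixes r :: int
  assumes "r \<ge> 10"
  shows "contractible_space (geometric_realization (VR_complex manhattan UNIV r))"
proof -
  \<comment> \<open>With the bound \<open>Suc n\<close> the exhaustion starts at the single point 0,
    since only 0 has \<open>zigzag\<close> value below 1.\<close>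
  let ?K = "\<lambda>n. VR_complex manhattan (zigzag_box (\<lambda>_ :: 6. Suc n)) r"
  have "(\<Union>n. ?K n) = VR_complex manhattan UNIV r"
  proof (intro equalityI subsetI)
    fix \<sigma> assume \<sigma>: "\<sigma> \<in> VR_complex manhattan UNIV r"
    define n where "n = Max ((\<lambda>(z, i). zigzag (z $ i)) ` (\<sigma> \<times> UNIV))"
    have "finite \<sigma>" using \<sigma> unfolding VR_complex_def by blast
    then have "zigzag (z $ i) \<le> n" if "z \<in> \<sigma>" for z i
      unfolding n_def using that by (intro Max_ge) (auto intro!: image_eqI[of _ _ "(z, i)"])
    then have "\<sigma> \<subseteq> zigzag_box (\<lambda>_. Suc n)" unfolding zigzag_box_def by (auto simp: less_Suc_eq_le)
    then have "\<sigma> \<in> ?K n" using \<sigma> unfolding VR_complex_def by blast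
    then show "\<sigma> \<in> (\<Union>n. ?K n)" by blast
  qed (auto simp: VR_complex_def)
  moreover have "contractible_space (geometric_realization (\<Union>n. ?K n))"
  proof (rule contractible_space_collapsing_union)
    show "finite_complex (?K n)" for n
      by (intro finite_complex_VR_complex finite_zigzag_box)
    show "collapses (?K (Suc n)) (?K n)" for n
      by (rule collapses_VR_cube_Suc[OF assms])
    have zero: "zigzag (z $ i) = 0 \<longleftrightarrow> z $ i = 0" for z :: "int^6" and i
      using zigzag_inject[of "z $ i" 0] unfolding zigzag_0 .
    have "zigzag_box (\<lambda>_ :: 6. Suc 0) = {0}"
      unfolding zigzag_box_def less_Suc0 zero by (auto simp: vec_eq_iff)
    moreover have "VR_complex manhattan {0} r = {{0}}"
    proof (intro equalityI subsetI)
      show "\<sigma> \<in> {{0}}" if "\<sigma> \<in> VR_complex manhattan {0} r" for \<sigma>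
        using that unfolding VR_complex_def by blast
    qed (use assms in \<open>simp add: VR_complex_def\<close>)
    ultimately show "?K 0 = {{0}}" by simp
  qed
  ultimately show ?thesis by simp
qed

end
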